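(* Let $q\in\Bbbk^{\times}$ and let $G\ge 1$ be an integer. The isomorphism classes of point modules over the graded algebra $B_q(G)$ are parametrized by the projective variety $\mathcal V(X_0X_2)=\{(p_0:p_1:p_2)\in\mathbb P^2(\Bbbk): p_0p_2=0\}$. The parametrization is given by $V\mapsto P_0=(a_0:b_0:c_0)$, where, for a point module $V=\bigoplus_{i\ge 0}\Bbbk v_i$ with $v_i\neq 0$ homogeneous of degree $i$, one has $x_1v_0=a_0v_1$, $x_2v_0=b_0v_1$, $z_0v_0=c_0v_1$; that is, this map is a well-defined bijection from the set of isomorphism classes of point modules onto $\mathcal V(X_0X_2)$.
   Context: $\Bbbk$ is an algebraically closed field of characteristic $0$. Modules are left modules. For $q\in\Bbbk^\times$ and an integer $G\ge 1$, $B_q(G)$ (the Laistrygonian Nichols algebra, denoted $\mathscr B(\mathfrak L_q(1,G))$) is the associative unital $\Bbbk$-algebra generated by $x_1,x_2,z_0,z_1,\dots,z_G$ with defining relations $$x_2x_1-x_1x_2+\tfrac12x_1^2=0,\quad x_1z_0=q\,z_0x_1,\quad z_nz_{n+1}=q^{-1}z_{n+1}z_n\ (0\le n\le G-1),$$ $$x_2z_n-q z_nx_2=z_{n+1}\ (0\le n\le G-1),\quad x_2z_G=q z_Gx_2 .$$ It is $\mathbb N_0$-graded with $\deg x_1=\deg x_2=1$, $\deg z_n=n+1$; thus it is generated in degree $1$ by $x_1,x_2,z_0$. Let $A=\bigoplus_{n\ge0}A^n$ be a graded $\Bbbk$-algebra with $A^0\simeq\Bbbk$, all $A^n$ finite-dimensional,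 generated in degree $1$. A point module over $A$ is a graded left $A$-module $V=\bigoplus_{n\ge0}V_n$ which is cyclic, generated in degree $0$, and satisfies $\dim_\Bbbk V_n=1$ for all $n\ge0$. Isomorphisms are isomorphisms of graded modules. *)

theory Defs
  imports
    "HOL-Computational_Algebra.Polynomial"
    "HOL-Library.Poly_Mapping"
    "HOL-Algebra.Module"
    "HOL-Algebra.QuotRing"
begin

text \<open>
  One record serves for graded \<open>k\<close>-algebras and for graded left modules over them. In a graded
  algebra, \<^const>\<open>smult\<close> is the action of the ground field, which is a type of class
  \<^class>\<open>field\<close>; in a graded left \<open>A\<close>-module it is the action of the elements of \<open>A\<close>, and the
  fields \<^const>\<open>mult\<close> and \<^const>\<open>one\<close> are irrelevant.
\<close>

record ('a, 'b) graded = "('a, 'b) module" +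
  hpart :: "nat \<Rightarrow> 'b set"


text \<open>
  The free algebra is the monoid algebra of the free monoid. The type of words is a copy of the
  type of lists, so as not to impose a class instance on \<^typ>\<open>'a list\<close> itself.
\<close>

datatype 'a free_word = Word (letters: "'a list")

instantiation free_word :: (type) monoid_add
begin

definition zero_free_word :: "'a free_word" where
  "0 = Word []"

definition plus_free_word :: "'a free_word \<Rightarrow> 'a free_word \<Rightarrow> 'a free_word" where
  "u + v = Word (letters u @ letters v)"

instance
  by standard (auto simp: zero_free_word_def plus_free_word_def)

end

type_synonym ('k, 'a) free_poly = "'a free_word \<Rightarrow>\<^sub>0 'k"

definition scal :: "'k::field \<Rightarrow> ('k, 'a) free_poly" where
  "scal c = Poly_Mapping.single 0 c"

definition var :: "'a \<Rightarrow> ('k::field, 'a) free_poly" where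
  "var x = Poly_Mapping.single (Word [x]) 1"

definition free_algebra :: "'a set \<Rightarrow> ('a \<Rightarrow> nat) \<Rightarrow> ('k::field, ('k, 'a) free_poly) graded" where
  "free_algebra X d =
    (let C = {f. \<forall>w \<in> Poly_Mapping.keys f. set (letters w) \<subseteq> X} in
     \<lparr>carrier = C, mult = (*), one = 1, zero = 0, add = (+),
      smult = (\<lambda>c f. scal c * f),
      hpart = (\<lambda>n. {f \<in> C. \<forall>w \<in> Poly_Mapping.keys f. sum_list (map d (letters w)) = n})\<rparr>)"

text \<open>
  The quotient of a graded algebra by an ideal. The images of the homogeneous components form a
  grading if the ideal is homogeneous.
\<close>

definition graded_quotient ::
  "('k, 'b) graded \<Rightarrow> 'b set \<Rightarrow> ('k, 'b set) graded" where
  "graded_quotient F I =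
     \<lparr>carrier = carrier (F Quot I), mult = mult (F Quot I), one = one (F Quot I),
      zero = zero (F Quot I), add = add (F Quot I),
      smult = (\<lambda>c Y. (I +>\<^bsub>F\<^esub> (c \<odot>\<^bsub>F\<^esub> \<one>\<^bsub>F\<^esub>)) \<otimes>\<^bsub>F Quot I\<^esub> Y),
      hpart = (\<lambda>n. (\<lambda>f. I +>\<^bsub>F\<^esub> f) ` hpart F n)\<rparr>"


datatype gen = X1 | X2 | Z nat

definition gens :: "nat \<Rightarrow> gen set" where
  "gens G = {X1, X2} \<union> Z ` {0..G}"

fun gen_deg :: "gen \<Rightarrow> nat" where
  "gen_deg X1 = 1"
| "gen_deg X2 = 1"
| "gen_deg (Z n) = n + 1"

definition B_free :: "nat \<Rightarrow> ('k::field, ('k, gen) free_poly) graded" where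
  "B_free G = free_algebra (gens G) gen_deg"

definition B_rels :: "'k::field \<Rightarrow> nat \<Rightarrow> ('k, gen) free_poly set" where
  "B_rels q G =
     (let x1 = var X1; x2 = var X2; z = (\<lambda>n. var (Z n)) in
       {x2 * x1 - x1 * x2 + scal (1 / 2) * x1 ^ 2,
        x1 * z 0 - scal q * z 0 * x1} \<union>
       {z n * z (n + 1) - scal (inverse q) * z (n + 1) * z n | n. n < G} \<union>
       {x2 * z n - scal q * z n * x2 - z (n + 1) | n. n < G} \<union>
       {x2 * z G - scal q * z G * x2})"

text \<open>\<^const>\<open>genideal\<close> is the two-sided ideal generated by a set.\<close>

definition B_ideal :: "'k::field \<Rightarrow> nat \<Rightarrow> ('k, gen) free_poly set" where
  "B_ideal q G = Idl\<^bsub>B_free G\<^esub> (B_rels q G)"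

definition B_alg :: "'k::field \<Rightarrow> nat \<Rightarrow> ('k, ('k, gen) free_poly set) graded" where
  "B_alg q G = graded_quotient (B_free G) (B_ideal q G)"

definition B_gen :: "'k::field \<Rightarrow> nat \<Rightarrow> gen \<Rightarrow> ('k, gen) free_poly set" where
  "B_gen q G g = B_ideal q G +>\<^bsub>B_free G :: ('k, ('k, gen) free_poly) graded\<^esub> var g"


text \<open>
  The axioms of the library's \<^locale>\<open>module\<close>, without commutativity of the ring.
\<close>

locale left_module = R?: ring A + M?: abelian_group V
  for A :: "('a, 'm) ring_scheme" (structure) and V :: "('a, 'v, 'n) module_scheme" (structure) +
  assumes smult_closed: "\<lbrakk>a \<in> carrier A; x \<in> carrier V\<rbrakk> \<Longrightarrow> a \<odot>\<^bsub>V\<^esub> x \<in> carrier V"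
    and smult_l_distr: "\<lbrakk>a \<in> carrier A; b \<in> carrier A; x \<in> carrier V\<rbrakk> \<Longrightarrow>
      (a \<oplus>\<^bsub>A\<^esub> b) \<odot>\<^bsub>V\<^esub> x = a \<odot>\<^bsub>V\<^esub> x \<oplus>\<^bsub>V\<^esub> b \<odot>\<^bsub>V\<^esub> x"
    and smult_r_distr: "\<lbrakk>a \<in> carrier A; x \<in> carrier V; y \<in> carrier V\<rbrakk> \<Longrightarrow>
      a \<odot>\<^bsub>V\<^esub> (x \<oplus>\<^bsub>V\<^esub> y) = a \<odot>\<^bsub>V\<^esub> x \<oplus>\<^bsub>V\<^esub> a \<odot>\<^bsub>V\<^esub> y"
    and smult_assoc1: "\<lbrakk>a \<in> carrier A; b \<in> carrier A; x \<in> carrier V\<rbrakk> \<Longrightarrow>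
      (a \<otimes>\<^bsub>A\<^esub> b) \<odot>\<^bsub>V\<^esub> x = a \<odot>\<^bsub>V\<^esub> (b \<odot>\<^bsub>V\<^esub> x)"
    and smult_one: "x \<in> carrier V \<Longrightarrow> \<one>\<^bsub>A\<^esub> \<odot>\<^bsub>V\<^esub> x = x"

text \<open>
  The components \<open>hpart V n\<close> are only required to be additive subgroups; over a graded
  \<open>k\<close>-algebra, whose component of degree \<open>0\<close> contains the scalars, they are then subspaces.
\<close>

definition graded_left_module :: "('k, 'a) graded \<Rightarrow> ('a, 'v) graded \<Rightarrow> bool" where
  "graded_left_module A V \<longleftrightarrow>
     left_module A V \<and>
     (\<forall>n. additive_subgroup (hpart V n) V) \<and>
     (\<forall>x \<in> carrier V. \<exists>!f. (\<forall>n. f n \<in> hpart V n) \<and> finite {n. f n \<noteq> \<zero>\<^bsub>V\<^esub>} \<and>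
        x = finsum V f {n. f n \<noteq> \<zero>\<^bsub>V\<^esub>}) \<and>
     (\<forall>i j. \<forall>a \<in> hpart A i. \<forall>x \<in> hpart V j. a \<odot>\<^bsub>V\<^esub> x \<in> hpart V (i + j))"

text \<open>The action of the ground field on a module over a \<open>k\<close>-algebra.\<close>

definition kscale :: "('k, 'a) graded \<Rightarrow> ('a, 'v) graded \<Rightarrow> 'k \<Rightarrow> 'v \<Rightarrow> 'v" where
  "kscale A V c x = (c \<odot>\<^bsub>A\<^esub> \<one>\<^bsub>A\<^esub>) \<odot>\<^bsub>V\<^esub> x"

text \<open>The last condition says that each component has a basis with exactly one element.\<close>

definition point_module :: "('k, 'a) graded \<Rightarrow> ('a, 'v) graded \<Rightarrow> bool" where
  "point_module A V \<longleftrightarrow>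
     graded_left_module A V \<and>
     (\<exists>v \<in> hpart V 0. carrier V = (\<lambda>a. a \<odot>\<^bsub>V\<^esub> v) ` carrier A) \<and>
     (\<forall>n. \<exists>v \<in> hpart V n. \<forall>x \<in> hpart V n. \<exists>!c. x = kscale A V c v)"

definition graded_iso ::
  "('k, 'a) graded \<Rightarrow> ('a, 'v) graded \<Rightarrow> ('a, 'w) graded \<Rightarrow> ('v \<Rightarrow> 'w) \<Rightarrow> bool" where
  "graded_iso A V W f \<longleftrightarrow>
     bij_betw f (carrier V) (carrier W) \<and>
     (\<forall>x \<in> carrier V. \<forall>y \<in> carrier V. f (x \<oplus>\<^bsub>V\<^esub> y) = f x \<oplus>\<^bsub>W\<^esub> f y) \<and>
     (\<forall>a \<in> carrier A. \<forall>x \<in> carrier V. f (a \<odot>\<^bsub>V\<^esub> x) = a \<odot>\<^bsub>W\<^esub> f x) \<and>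
     (\<forall>n. f ` hpart V n \<subseteq> hpart W n)"

definition point_module_iso_rel ::
  "('k, 'a) graded \<Rightarrow> (('a, 'v) graded \<times> ('a, 'v) graded) set" where
  "point_module_iso_rel A =
     {(V, W). point_module A V \<and> point_module A W \<and> (\<exists>f. graded_iso A V W f)}"

definition iso_class :: "('k, 'a) graded \<Rightarrow> ('a, 'v) graded \<Rightarrow> ('a, 'v) graded set" where
  "iso_class A V = point_module_iso_rel A `` {V}"

definition point_module_classes :: "('k, 'a) graded \<Rightarrow> ('a, 'v) graded set set" where
  "point_module_classes A = {V. point_module A V} // point_module_iso_rel A"


definition proj_point :: "'k::field \<Rightarrow> 'k \<Rightarrow> 'k \<Rightarrow> ('k \<times> 'k \<times> 'k) set" where
  "proj_point a b c = {(t * a, t * b, t * c) | t. t \<noteq> 0}"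

definition proj_plane :: "('k::field \<times> 'k \<times> 'k) set set" where
  "proj_plane = {proj_point a b c | a b c. (a, b, c) \<noteq> (0, 0, 0)}"

definition variety_X0X2 :: "('k::field \<times> 'k \<times> 'k) set set" where
  "variety_X0X2 = {P \<in> proj_plane. \<forall>(p0, p1, p2) \<in> P. p0 * p2 = 0}"

text \<open>
  Point modules have their carriers in an arbitrary type \<open>'v\<close>. Since a point module over a
  \<open>k\<close>-algebra is a \<open>k\<close>-vector space of countably infinite dimension, a type \<open>'v\<close> carries point
  modules only if there is an injection from \<^typ>\<open>nat \<Rightarrow>\<^sub>0 'k\<close> (finitely supported sequences)
  into it. Statements on the set of all isomorphism classes therefore assume such an injection,
  which makes \<open>'v\<close> a large enough universe.
\<close>

end

theory Submission
  imports Defs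
begin

text \<open>
  In a basis \<open>v\<^sub>n\<close> of homogeneous vectors a point module is a family of structure constants, and the
  defining relations become equations between them. Put \<open>P\<^sub>n = (a\<^sub>n : b\<^sub>n : c\<^sub>n)\<close> for the action of
  \<open>x\<^sub>1, x\<^sub>2, z\<^sub>0\<close> on \<open>v\<^sub>n\<close>. If \<open>a\<^sub>0 \<noteq> 0\<close>, then all \<open>a\<^sub>n \<noteq> 0\<close>, \<open>b\<^sub>n / a\<^sub>n = b\<^sub>0 / a\<^sub>0 - n / 2\<close>, and every
  \<open>z\<^sub>k\<close> is a nonzero multiple of \<open>c\<^sub>0\<close>, so \<open>x\<^sub>2 z\<^sub>G = q z\<^sub>G x\<^sub>2\<close> forces \<open>c\<^sub>0 = 0\<close>. If \<open>a\<^sub>0 = 0\<close>, then all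
  \<open>a\<^sub>n = 0\<close>, and a trace argument applied to the central element \<open>z\<^sub>G\<close>, then to \<open>z\<^sub>G\<^sub>-\<^sub>1\<close> and so on, shows
  that \<open>z\<^sub>1, \<dots>, z\<^sub>G\<close> act by zero; hence \<open>P\<^sub>n\<close> is determined by \<open>P\<^sub>0\<close>. Both cases lead to the same
  normal form \<open>x\<^sub>1 = a\<^sub>0\<close>, \<open>x\<^sub>2 = b\<^sub>0 - n a\<^sub>0 / 2\<close>, \<open>z\<^sub>0 = c\<^sub>0 q\<^sup>-\<^sup>n\<close>, \<open>z\<^sub>k = 0\<close>, which conversely defines a
  point module whenever \<open>a\<^sub>0 c\<^sub>0 = 0\<close>.
\<close>

section \<open>Equations between the structure constants\<close>

text \<open>The bracket with x2 is a derivation. Applied to [z_k, z_(k+e)] = 0 it gives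
  [z_(k+1), z_(k+e)] + [z_k, z_(k+e+1)] = 0, and the first term vanishes because its indices differ
  only by e - 1. Hence the strong induction on the difference \<open>d\<close> of the indices. The
  shifts in the arguments are degrees: z_k raises the degree by k + 1.\<close>

lemma filiform_commute:
  fixes b :: "nat \<Rightarrow> 'k::field" and C :: "nat \<Rightarrow> nat \<Rightarrow> 'k"
  assumes comm: "\<And>k n. k < G \<Longrightarrow> C k (n + k + 2) * C (k + 1) n = C (k + 1) (n + k + 1) * C k n"
    and bracket: "\<And>k n. k < G \<Longrightarrow> b (n + k + 1) * C k n - C k (n + 1) * b n = C (k + 1) n"
    and "k + d \<le> G"
  shows "C k (n + k + d + 1) * C (k + d) n = C (k + d) (n + k + 1) * C k n"
  using \<open>k + d \<le> G\<close>
proof (induction d arbitrary: k n rule: less_induct)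
  case (less d)
  consider "d = 0" | "d = 1" | e where "d = Suc e" "e \<ge> 1"
    by (metis One_nat_def Suc_le_eq less_numeral_extra(3) not0_implies_Suc old.nat.exhaust zero_less_Suc)
  then show ?case
  proof cases
    case 1
    then show ?thesis by simp
  next
    case 2
    then show ?thesis using comm[of k n] less.prems by simp
  next
    case 3
    have le: "k + e < G" "k < G" "k + 1 + (e - 1) \<le> G" "k + e \<le> G" using less.prems 3 by auto
    have A1: "C (k + d) n = b (n + k + e + 1) * C (k + e) n - C (k + e) (n + 1) * b n"
      using bracket[OF le(1), of n] 3 by (simp add: add_ac)
    have A2: "C (k + d) (n + k + 1) =
        b (n + k + k + e + 2) * C (k + e) (n + k + 1) - C (k + e) (n + k + 2) * b (n + k + 1)"
      using bracket[OF le(1), of "n + k + 1"] 3 by (simp add: add_ac)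
    have A3: "b (n + k + k + e + 2) * C k (n + k + e + 1) - C k (n + k + e + 2) * b (n + k + e + 1)
        = C (k + 1) (n + k + e + 1)"
      using bracket[OF le(2), of "n + k + e + 1"] by (simp add: add_ac)
    have A4: "b (n + k + 1) * C k n - C k (n + 1) * b n = C (k + 1) n"
      using bracket[OF le(2), of n] by simp
    have I1: "C k (n + k + e + 1) * C (k + e) n = C (k + e) (n + k + 1) * C k n"
      using less.IH[of e k n] 3 le by simp
    have I2: "C k (n + k + e + 2) * C (k + e) (n + 1) = C (k + e) (n + k + 2) * C k (n + 1)"
      using less.IH[of e k "n + 1"] 3 le by (simp add: add_ac)
    have I3: "C (k + 1) (n + k + e + 1) * C (k + e) n = C (k + e) (n + k + 2) * C (k + 1) n"
      using less.IH[of "e - 1" "k + 1" n] 3 le by (simp add: add_ac)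
    \<comment> \<open>The derivation argument as a polynomial identity in anonymous scalars: the
      premises are two bracket relations and three commutations, matched one by one with
      \<open>A3\<close>, \<open>A4\<close>, \<open>I1\<close>, \<open>I2\<close>,
      \<open>I3\<close>.\<close>
    have "c2 * (b1 * e - e1 * b) = (B * f - f1 * b2) * c"
      if "B * c1 - c2 * b1 = d1" "b2 * c - c3 * b = d"
        "c1 * e = f * c" "c2 * e1 = f1 * c3" "d1 * e = f1 * d"
      for B b b1 b2 c c1 c2 c3 d d1 e e1 f f1 :: 'k
    proof -
      have "c2 * (b1 * e - e1 * b) - (B * f - f1 * b2) * c =
          - (B * c1 - c2 * b1) * e + f1 * (b2 * c - c3 * b) + B * (c1 * e - f * c) - (c2 * e1 - f1 * c3) * b"
        by (simp add: algebra_simps)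
      also have "\<dots> = 0" using that by simp
      finally show ?thesis by simp
    qed
    from this[OF A3 A4 I1 I2 I3]
    have "C k (n + k + e + 2) * (b (n + k + e + 1) * C (k + e) n - C (k + e) (n + 1) * b n)
      = (b (n + k + k + e + 2) * C (k + e) (n + k + 1) - C (k + e) (n + k + 2) * b (n + k + 1)) * C k n" .
    then show ?thesis using A1 A2 3 by (simp add: add_ac)
  qed
qed

text \<open>The operator \<open>z\<^sub>G\<close> is central. If it does not vanish, it vanishes in no degree and makes
  the sequence of points periodic; then \<open>w\<close> is periodic with period \<open>G + 1\<close>, whereas
  \<open>w (n + 1) = w n - 1\<close>. This is the trace argument against a finite-dimensional representation of
  \<open>[x\<^sub>2, z\<^sub>G\<^sub>-\<^sub>1] = 1\<close>.\<close>

lemma filiform_vanish: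
  fixes b :: "nat \<Rightarrow> 'k::field_char_0" and C :: "nat \<Rightarrow> nat \<Rightarrow> 'k"
  assumes comm: "\<And>k n. k < G \<Longrightarrow> C k (n + k + 2) * C (k + 1) n = C (k + 1) (n + k + 1) * C k n"
    and bracket: "\<And>k n. k < G \<Longrightarrow> b (n + k + 1) * C k n - C k (n + 1) * b n = C (k + 1) n"
    and top: "\<And>n. b (n + G + 1) * C G n = C G (n + 1) * b n"
    and ne: "\<And>n. b n \<noteq> 0 \<or> C 0 n \<noteq> 0"
    and "1 \<le> k" "k \<le> G"
  shows "C k n = 0"
  using assms
proof (induction G)
  case 0
  then show ?case by simp
next
  case (Suc G)
  have zero: "C (Suc G) n = 0" for n
  proof (rule ccontr)
    assume nz: "C (Suc G) n \<noteq> 0"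
    let ?\<gamma> = "C (Suc G)"
    \<comment> \<open>With \<open>bb\<close>: the top operator commutes with z_0 and x2. In the
      induction step the top index is \<open>Suc G\<close>, so it raises the degree by G +
      2.\<close>
    have c0: "C 0 (n + G + 2) * ?\<gamma> n = ?\<gamma> (n + 1) * C 0 n" for n
      using filiform_commute[of "Suc G" C b 0 "Suc G" n] Suc.prems(1,2) by simp
    have bb: "b (n + G + 2) * ?\<gamma> n = ?\<gamma> (n + 1) * b n" for n
      using Suc.prems(3)[of n] by simp
    \<comment> \<open>Some \<open>b\<close> or \<open>C 0\<close> is nonzero in degree n + G + 2;
      the left-hand side of \<open>bb\<close> or \<open>c0\<close> is then nonzero, and so is the
      factor \<open>?\<gamma> (n + 1)\<close> on the right. In degree n + G + 2 only these two
      matter.\<close>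
    have step: "?\<gamma> (n + 1) \<noteq> 0" if "?\<gamma> n \<noteq> 0" for n
      using that Suc.prems(4)[of "n + G + 2"] c0[of n] bb[of n] by auto
    have all: "?\<gamma> (n + i) \<noteq> 0" for i
      by (induction i) (use nz step in \<open>auto simp: add_ac\<close>)
    \<comment> \<open>The quotient of the coefficients of x2 z_G and of the top operator on the same
      basis vector; both raise the degree by G + 2, so \<open>w\<close> does not depend on the
      scaling of the basis.\<close>
    define w where "w i = b (n + i + G + 1) * C G (n + i) / ?\<gamma> (n + i)" for i
    have w_Suc: "w (Suc i) = w i - 1" for i
    proof -
      have "b (n + i + G + 1) * C G (n + i) - C G (n + i + 1) * b (n + i) = ?\<gamma> (n + i)"
        using Suc.prems(2)[of G "n + i"] by simp
      moreover have "b (n + i + G + 2) * ?\<gamma> (n + i) = ?\<gamma> (n + i + 1) * b (n + i)"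
        using bb by blast
      moreover have "B' * c' * g = (B * c - g) * g'" if "B * c - c' * b = g" "B' * g = g' * b"
        for B B' b c c' g g' :: 'k
        using that by (auto simp: algebra_simps)
      ultimately have "b (n + i + G + 2) * C G (n + i + 1) * ?\<gamma> (n + i) =
          (b (n + i + G + 1) * C G (n + i) - ?\<gamma> (n + i)) * ?\<gamma> (n + i + 1)"
        by blast
      then show ?thesis
        using all[of i] all[of "Suc i"] by (simp add: w_def add_ac divide_simps)
    qed
    have w: "w i = w 0 - of_nat i" for i
      by (induction i) (auto simp: w_Suc)
    \<comment> \<open>The top operator commutes with x2 and z_G and shifts degrees by G + 2, so it
      carries the quotient in degree n to that in degree n + G + 2. In characteristic 0 this
      contradicts the decrease by 1 in each step.\<close>
    have "w (G + 2) = w 0"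
    proof -
      have "b (n + G + 1 + G + 2) * ?\<gamma> (n + G + 1) = ?\<gamma> (n + G + 2) * b (n + G + 1)"
        using bb[of "n + G + 1"] by (simp add: add_ac)
      moreover have "C G (n + G + 2) * ?\<gamma> n = ?\<gamma> (n + G + 1) * C G n"
        using Suc.prems(1)[of G n] by simp
      moreover have "B * c' * g = b * c * g'" if "B * h = g' * b" "c' * g = h * c"
        for B b c c' g g' h :: 'k
        using that by (metis mult.assoc mult.commute)
      ultimately have "b (n + G + 1 + G + 2) * C G (n + G + 2) * ?\<gamma> n =
          b (n + G + 1) * C G n * ?\<gamma> (n + G + 2)"
        by blast
      then show ?thesis
        using all[of 0] all[of "G + 2"] by (simp add: w_def add_ac divide_simps)
    qed
    then show False using w[of "G + 2"] by (simp del: of_nat_add of_nat_Suc add_2_eq_Suc')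
  qed
  show ?case
  proof (cases "k = Suc G")
    case True
    then show ?thesis using zero by simp
  next
    case False
    show ?thesis
    proof (rule Suc.IH)
      \<comment> \<open>Once the top operator is zero, the last bracket relation says that x2
        commutes with z_G: this is the top relation for the smaller index.\<close>
      show "b (n + G + 1) * C G n = C G (n + 1) * b n" for n
        using Suc.prems(2)[of G n] zero[of n] by simp
    qed (use Suc.prems False in auto)
  qed
qed

text \<open>The hypotheses are the defining relations for q = 1, read off on the basis vectors. The
  factors \<open>\<mu>\<close> are a change of basis: with w_n = \<open>\<mu> n\<close> v_n, an
  equation such as \<open>a n * \<mu> n = a 0 * \<mu> (Suc n)\<close> says that x1 sends w_n to
  \<open>a 0\<close> times w_(n+1).\<close>

lemma point_normal_form:
  fixes a b :: "nat \<Rightarrow> 'k::field_char_0" and C :: "nat \<Rightarrow> nat \<Rightarrow> 'k"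
  assumes ab: "\<And>n. b (n + 1) * a n - a (n + 1) * b n + 1 / 2 * a (n + 1) * a n = 0"
    and aC: "\<And>n. a (n + 1) * C 0 n = C 0 (n + 1) * a n"
    and comm: "\<And>k n. k < G \<Longrightarrow> C k (n + k + 2) * C (k + 1) n = C (k + 1) (n + k + 1) * C k n"
    and bracket: "\<And>k n. k < G \<Longrightarrow> b (n + k + 1) * C k n - C k (n + 1) * b n = C (k + 1) n"
    and top: "\<And>n. b (n + G + 1) * C G n = C G (n + 1) * b n"
    and ne: "\<And>n. a n \<noteq> 0 \<or> b n \<noteq> 0 \<or> C 0 n \<noteq> 0"
    and G: "G \<ge> 1"
  shows "a 0 * C 0 0 = 0 \<and> (\<forall>k n. 1 \<le> k \<longrightarrow> k \<le> G \<longrightarrow> C k n = 0) \<and>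
    (\<exists>\<mu>. \<mu> 0 = 1 \<and> (\<forall>n. \<mu> n \<noteq> 0 \<and> a n * \<mu> n = a 0 * \<mu> (Suc n) \<and>
      b n * \<mu> n = (b 0 - of_nat n / 2 * a 0) * \<mu> (Suc n) \<and> C 0 n * \<mu> n = C 0 0 * \<mu> (Suc n)))"
proof (cases "a 0 = 0")
  case False
  have a: "a n \<noteq> 0" for n
  proof (induction n)
    case (Suc n)
    \<comment> \<open>If \<open>a (n + 1)\<close> were zero, the two relations involving
      \<open>a n\<close>, which is nonzero, would force \<open>b (n + 1)\<close> and
      \<open>C 0 (n + 1)\<close> to vanish as well.\<close>
    then show ?case using ab[of n] aC[of n] ne[of "n + 1"] by auto
  qed (use False in simp)
  define \<mu> where "\<mu> n = (\<Prod>i<n. a i / a 0)" for n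
  have \<mu>: "\<mu> n \<noteq> 0" "\<mu> (Suc n) = a n / a 0 * \<mu> n" for n
    using a by (auto simp: \<mu>_def)
  \<comment> \<open>Division of the relation \<open>ab\<close> by \<open>a n * a (n + 1)\<close>
    turns it into a recursion with constant decrement 1/2.\<close>
  have "b n / a n = b 0 / a 0 - of_nat n / 2" for n
  proof (induction n)
    case (Suc n)
    have "B * (a * 2) = (b * 2 - a) * a'" if "B * a * 2 - a' * b * 2 + a' * a = 0" for B b a a' :: 'k
      using that by (simp add: algebra_simps add_eq_0_iff eq_diff_eq diff_eq_eq)
    from this[of "b (Suc n)" "a n" "a (Suc n)" "b n"]
    have "b (Suc n) / a (Suc n) = b n / a n - 1 / 2"
      using ab[of n] a[of n] a[of "Suc n"] by (simp add: divide_simps)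
    then show ?case using Suc by (simp add: add_divide_distrib)
  qed simp
  then have b: "b n = a n * (b 0 / a 0 - of_nat n / 2)" for n
    using a[of n] by (metis nonzero_mult_div_cancel_left times_divide_eq_right)
  \<comment> \<open>In the rescaled basis x2 is affine in the degree with slope
    \<open>- a 0 / 2\<close>. If z_k acts there by a constant t, then, since it raises the degree by
    k + 1, its bracket with x2 acts by the constant - t (k + 1) a_0 / 2.\<close>
  have bracket_eq: "b (n + k + 1) * C k n - C k (n + 1) * b n =
      - t * (of_nat (Suc k) / 2 * a 0) * \<mu> (n + Suc k + 1) / \<mu> n"
    if t: "\<And>n. C k n = t * \<mu> (n + k + 1) / \<mu> n" for k n t
  proof -
    have calc: "m\<^sub>2 / m\<^sub>1 * \<alpha> * (\<beta> - (i + j) / 2) * (t * m\<^sub>1 / m\<^sub>0) - t * m\<^sub>2 / m * (m / m\<^sub>0 * \<alpha> * (\<beta> - i / 2)) =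
        - t * (j / 2 * \<alpha>) * m\<^sub>2 / m\<^sub>0" if "m\<^sub>1 \<noteq> 0" "m \<noteq> 0" for t m m\<^sub>0 m\<^sub>1 m\<^sub>2 \<alpha> \<beta> i j :: 'k
    proof -
      have "m\<^sub>2 / m\<^sub>1 * \<alpha> * (\<beta> - (i + j) / 2) * (t * m\<^sub>1 / m\<^sub>0) - t * m\<^sub>2 / m * (m / m\<^sub>0 * \<alpha> * (\<beta> - i / 2)) =
          t * \<alpha> * m\<^sub>2 / m\<^sub>0 * (\<beta> - (i + j) / 2) - t * \<alpha> * m\<^sub>2 / m\<^sub>0 * (\<beta> - i / 2)"
        using that by (simp add: mult_ac)
      also have "\<dots> = t * \<alpha> * m\<^sub>2 / m\<^sub>0 * ((\<beta> - (i + j) / 2) - (\<beta> - i / 2))"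
        by (simp only: right_diff_distrib)
      also have "(\<beta> - (i + j) / 2) - (\<beta> - i / 2) = - (j / 2)" by (simp add: add_divide_distrib)
      finally show ?thesis by (simp add: mult_ac)
    qed
    have bm: "b i = \<mu> (Suc i) / \<mu> i * a 0 * (b 0 / a 0 - of_nat i / 2)" for i
      using \<mu>(2)[of i] \<mu>(1)[of i] b[of i] False by simp
    show ?thesis
      using calc[of "\<mu> (n + k + 1)" "\<mu> (n + 1)" "\<mu> (n + k + 2)" "a 0" "b 0 / a 0" "of_nat n" "of_nat (Suc k)" t "\<mu> n"] \<mu>(1)
      unfolding bm[of "n + k + 1"] bm[of n] t by (simp add: add_ac)
  qed
  \<comment> \<open>Every z_k acts by a constant in the rescaled basis. Each bracket multiplies it
    by a factor that is nonzero in characteristic 0, so it stays nonzero as long as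
    \<open>C 0 0\<close> is.\<close>
  have C: "\<exists>t. (C 0 0 \<noteq> 0 \<longrightarrow> t \<noteq> 0) \<and> (\<forall>n. C k n = t * \<mu> (n + k + 1) / \<mu> n)"
    if "k \<le> G" for k
    using that
  proof (induction k)
    case 0
    have "C 0 n = C 0 0 * (\<mu> (Suc n) / \<mu> n)" for n
    proof (induction n)
      case (Suc n)
      have "C 0 (Suc n) = a (Suc n) / a n * C 0 n" using aC[of n] a[of n] by (simp add: divide_simps)
      then show ?case using Suc \<mu>(1)[of n] a[of n] False by (simp add: \<mu>(2))
    qed (use \<mu>(2)[of 0] False in \<open>simp add: \<mu>_def\<close>)
    then have "C 0 n = C 0 0 * \<mu> (n + 0 + 1) / \<mu> n" for n
      by (metis Suc_eq_plus1 add_0_right times_divide_eq_right)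
    then show ?case by blast
  next
    case (Suc k)
    then obtain t where t: "C 0 0 \<noteq> 0 \<Longrightarrow> t \<noteq> 0" "\<And>n. C k n = t * \<mu> (n + k + 1) / \<mu> n" by auto
    have "C (Suc k) n = - t * (of_nat (Suc k) / 2 * a 0) * \<mu> (n + Suc k + 1) / \<mu> n" for n
      using bracket[of k n] bracket_eq[OF t(2), of n] Suc by simp
    then show ?case using t(1) False
      by (intro exI[of _ "- t * (of_nat (Suc k) / 2 * a 0)"]) (auto simp del: of_nat_Suc)
  qed
  have C00: "C 0 0 = 0"
  proof (rule ccontr)
    assume nz: "C 0 0 \<noteq> 0"
    with C[of G] obtain t where t: "t \<noteq> 0" "\<And>n. C G n = t * \<mu> (n + G + 1) / \<mu> n" by auto
    then show False
      \<comment> \<open>One more bracket, that of x2 with z_G, would again be nonzero, whereas the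
        top relation makes it zero.\<close>
      using bracket_eq[OF t(2), of 0] top[of 0] \<mu>(1) False by (simp del: of_nat_Suc)
  qed
  have C0: "C 0 n = 0" for n
  proof (induction n)
    case (Suc n)
    then show ?case using aC[of n] a[of n] by simp
  qed (use C00 in simp)
  have Ck: "C k n = 0" if "k \<le> G" for k n
    using that
  proof (induction k arbitrary: n)
    case (Suc k)
    then show ?case using bracket[of k n] by simp
  qed (use C0 in simp)
  show ?thesis
  proof (intro conjI allI impI exI[of _ \<mu>])
    fix n
    show "b n * \<mu> n = (b 0 - of_nat n / 2 * a 0) * \<mu> (Suc n)"
      using False by (subst b) (simp add: \<mu>(2) diff_divide_distrib right_diff_distrib left_diff_distrib mult_ac)
  qed (use C00 C0 Ck False \<mu> in \<open>simp_all add: \<mu>_def[of 0]\<close>)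
next
  case True
  have a: "a n = 0" for n
  proof (induction n)
    case (Suc n)
    \<comment> \<open>With \<open>a n = 0\<close> the relations give
      \<open>a (n + 1) * b n = 0\<close> and \<open>a (n + 1) * C 0 n = 0\<close>, and one of
      \<open>b n\<close>, \<open>C 0 n\<close> is nonzero.\<close>
    then show ?case using ab[of n] aC[of n] ne[of n] by auto
  qed (use True in simp)
  have Ck: "C k n = 0" if "1 \<le> k" "k \<le> G" for k n
    by (rule filiform_vanish[of G C b]) (use assms a that in auto)
  \<comment> \<open>As z_1 = 0, the first bracket relation states that consecutive points are
    proportional; hence all are proportional to the first, with a factor \<open>s n\<close> whose
    partial products give \<open>\<mu>\<close>.\<close>
  have par: "b (n + 1) * C 0 n = C 0 (n + 1) * b n" for n
    using bracket[of 0 n] Ck[of 1 n] G by simp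
  have "\<exists>s. s \<noteq> 0 \<and> b n = s * b 0 \<and> C 0 n = s * C 0 0" for n
  proof (induction n)
    case (Suc n)
    then obtain s where s: "s \<noteq> 0" "b n = s * b 0" "C 0 n = s * C 0 0" by blast
    have p: "b (n + 1) * C 0 0 = C 0 (n + 1) * b 0" using par[of n] s by simp
    show ?case
    proof (cases "b 0 = 0")
      case b0: True
      then have "C 0 0 \<noteq> 0" using ne[of 0] True by simp
      then show ?thesis using b0 p ne[of "n + 1"] a
        by (intro exI[of _ "C 0 (n + 1) / C 0 0"]) auto
    next
      case b0: False
      then show ?thesis using p ne[of "n + 1"] a
        by (intro exI[of _ "b (n + 1) / b 0"]) (auto simp: field_simps)
    qed
  qed (intro exI[of _ 1], simp)
  then obtain s where s: "\<And>n. s n \<noteq> 0 \<and> b n = s n * b 0 \<and> C 0 n = s n * C 0 0" by metis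
  show ?thesis
  proof (intro conjI allI impI exI[of _ "\<lambda>n. \<Prod>i<n. s i"])
    fix n
    show "b n * (\<Prod>i<n. s i) = (b 0 - of_nat n / 2 * a 0) * (\<Prod>i<Suc n. s i)"
      "C 0 n * (\<Prod>i<n. s i) = C 0 0 * (\<Prod>i<Suc n. s i)"
      using s[of n] True by (simp_all add: mult_ac)
  qed (use a Ck s[THEN conjunct1] in simp_all)
qed

section \<open>Weighted shift representations of the free algebra\<close>

text \<open>Induction by adding one monomial at a time. It reduces additive statements to single
  words of the free algebra and to single basis vectors.\<close>

lemma poly_mapping_induct [consumes 1, case_names zero add]:
  fixes f :: "'a \<Rightarrow>\<^sub>0 'b::comm_monoid_add"
  assumes "Poly_Mapping.keys f \<subseteq> K"
    and zero: "P 0"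
    and add: "\<And>k s g. k \<in> K \<Longrightarrow> Poly_Mapping.keys g \<subseteq> K \<Longrightarrow> P g \<Longrightarrow> P (Poly_Mapping.single k s + g)"
  shows "P f"
proof -
  have "S \<subseteq> K \<Longrightarrow> Poly_Mapping.keys (\<Sum>k\<in>S. Poly_Mapping.single k (Poly_Mapping.lookup f k)) \<subseteq> K \<and>
      P (\<Sum>k\<in>S. Poly_Mapping.single k (Poly_Mapping.lookup f k))" if "finite S" for S
    using that
  proof (induction S)
    case (insert k S)
    then show ?case
      using add[of k "\<Sum>k\<in>S. Poly_Mapping.single k (Poly_Mapping.lookup f k)" "Poly_Mapping.lookup f k"]
        keys_add[of "Poly_Mapping.single k (Poly_Mapping.lookup f k)" "\<Sum>k\<in>S. Poly_Mapping.single k (Poly_Mapping.lookup f k)"]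
      by (auto split: if_splits)
  qed (use zero in auto)
  moreover have "f = (\<Sum>k\<in>Poly_Mapping.keys f. Poly_Mapping.single k (Poly_Mapping.lookup f k))"
    by (rule poly_mapping_eqI) (auto simp: lookup_sum lookup_single when_def in_keys_iff)
  ultimately show ?thesis using assms(1) finite_keys by metis
qed

text \<open>The coefficient with which a word acts on the basis vector of degree \<open>n\<close>.
  Since modules are left modules, the last letter acts first, and the head meets the degree already
  raised by the tail.\<close>

fun weight :: "('a \<Rightarrow> nat) \<Rightarrow> ('a \<Rightarrow> nat \<Rightarrow> 'k::field) \<Rightarrow> 'a list \<Rightarrow> nat \<Rightarrow> 'k" where
  "weight d c [] n = 1"
| "weight d c (x # w) n = c x (n + sum_list (map d w)) * weight d c w n"

text \<open>The action of the free algebra on \<open>\<Oplus>\<^sub>n k e\<^sub>n\<close> in which a letter \<open>x\<close> sends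
  \<open>e\<^sub>n\<close> to \<open>c x n\<close> times \<open>e\<close> in degree \<open>n + d x\<close>.\<close>

definition shift_act :: "('a \<Rightarrow> nat) \<Rightarrow> ('a \<Rightarrow> nat \<Rightarrow> 'k::field) \<Rightarrow> ('k, 'a) free_poly \<Rightarrow>
    (nat \<Rightarrow>\<^sub>0 'k) \<Rightarrow> (nat \<Rightarrow>\<^sub>0 'k)" where
  "shift_act d c f h = (\<Sum>w\<in>Poly_Mapping.keys f. \<Sum>n\<in>Poly_Mapping.keys h.
     Poly_Mapping.single (n + sum_list (map d (letters w)))
       (Poly_Mapping.lookup f w * weight d c (letters w) n * Poly_Mapping.lookup h n))"

lemma weight_append:
  "weight d c (u @ w) n = weight d c u (n + sum_list (map d w)) * weight d c w n"
  by (induction u) (auto simp: algebra_simps)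

lemma shift_act_add_left: "shift_act d c (f + g) h = shift_act d c f h + shift_act d c g h"
  unfolding shift_act_def
  by (rule setsum_keys_plus_distrib) (auto simp: single_add distrib_right sum.distrib)

lemma shift_act_add_right: "shift_act d c f (g + h) = shift_act d c f g + shift_act d c f h"
proof -
  have "(\<Sum>n\<in>Poly_Mapping.keys (g + h). Poly_Mapping.single (n + sum_list (map d (letters w)))
       (Poly_Mapping.lookup f w * weight d c (letters w) n * Poly_Mapping.lookup (g + h) n)) =
    (\<Sum>n\<in>Poly_Mapping.keys g. Poly_Mapping.single (n + sum_list (map d (letters w)))
       (Poly_Mapping.lookup f w * weight d c (letters w) n * Poly_Mapping.lookup g n)) +
    (\<Sum>n\<in>Poly_Mapping.keys h. Poly_Mapping.single (n + sum_list (map d (letters w)))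
       (Poly_Mapping.lookup f w * weight d c (letters w) n * Poly_Mapping.lookup h n))" for w
    by (rule setsum_keys_plus_distrib) (auto simp: single_add distrib_left)
  then show ?thesis by (simp add: shift_act_def sum.distrib)
qed

lemma shift_act_zero [simp]: "shift_act d c 0 h = 0" "shift_act d c f 0 = 0"
  by (simp_all add: shift_act_def)

lemma shift_act_single:
  "shift_act d c (Poly_Mapping.single w s) (Poly_Mapping.single n t) =
    Poly_Mapping.single (n + sum_list (map d (letters w))) (s * weight d c (letters w) n * t)"
  by (simp add: shift_act_def)

lemma shift_act_uminus: "shift_act d c (- f) h = - shift_act d c f h"
  using shift_act_add_left[of d c f "- f" h] by (simp add: eq_neg_iff_add_eq_0 add.commute)

lemma shift_act_diff: "shift_act d c (f - g) h = shift_act d c f h - shift_act d c g h"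
  using shift_act_add_left[of d c f "- g" h] by (simp add: shift_act_uminus)

lemma shift_act_mult: "shift_act d c (f * g) h = shift_act d c f (shift_act d c g h)"
proof -
  \<comment> \<open>Associativity for words on a basis vector is \<open>weight_append\<close>;
    additivity then extends it to arbitrary vectors, right factors and left factors in turn.\<close>
  have 1: "shift_act d c (Poly_Mapping.single u r * Poly_Mapping.single w s) (Poly_Mapping.single n t) =
      shift_act d c (Poly_Mapping.single u r) (shift_act d c (Poly_Mapping.single w s) (Poly_Mapping.single n t))"
    for u w r s n t
    by (simp add: mult_single shift_act_single plus_free_word_def weight_append algebra_simps)
  have 2: "shift_act d c (Poly_Mapping.single u r * Poly_Mapping.single w s) h =
      shift_act d c (Poly_Mapping.single u r) (shift_act d c (Poly_Mapping.single w s) h)"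
    for u w r s h
    using subset_UNIV[of "Poly_Mapping.keys h"]
    by (induction h rule: poly_mapping_induct) (auto simp: shift_act_add_right 1)
  have 3: "shift_act d c (Poly_Mapping.single u r * g) h =
      shift_act d c (Poly_Mapping.single u r) (shift_act d c g h)" for u r g h
    using subset_UNIV[of "Poly_Mapping.keys g"]
    by (induction g rule: poly_mapping_induct)
      (auto simp: shift_act_add_right shift_act_add_left distrib_left 2)
  show ?thesis
    using subset_UNIV[of "Poly_Mapping.keys f"]
    by (induction f rule: poly_mapping_induct) (auto simp: shift_act_add_left distrib_right 3)
qed

lemma shift_act_one [simp]: "shift_act d c 1 h = h"
proof -
  have 1: "shift_act d c 1 (Poly_Mapping.single n t) = Poly_Mapping.single n t" for n t
    using shift_act_single[of d c 0 1 n t] by (simp add: zero_free_word_def flip: single_one)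
  show ?thesis
    using subset_UNIV[of "Poly_Mapping.keys h"]
    by (induction h rule: poly_mapping_induct) (auto simp: shift_act_add_right 1)
qed

lemma shift_act_scal_single: "shift_act d c (scal s) (Poly_Mapping.single n t) = Poly_Mapping.single n (s * t)"
  by (simp add: scal_def shift_act_single zero_free_word_def)

lemma shift_act_var_single:
  "shift_act d c (var x) (Poly_Mapping.single n t) = Poly_Mapping.single (n + d x) (c x n * t)"
  by (simp add: var_def shift_act_single)

lemma keys_shift_act:
  assumes "\<And>w. w \<in> Poly_Mapping.keys f \<Longrightarrow> sum_list (map d (letters w)) = i"
    and "Poly_Mapping.keys h \<subseteq> {j}"
  shows "Poly_Mapping.keys (shift_act d c f h) \<subseteq> {i + j}"
proof -
  have "Poly_Mapping.lookup (shift_act d c f h) m = 0" if "m \<noteq> i + j" for m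
    unfolding shift_act_def lookup_sum
    by (intro sum.neutral ballI) (use assms that in \<open>auto simp: lookup_single when_def add.commute\<close>)
  then show ?thesis by (auto simp: in_keys_iff)
qed

section \<open>Graded modules over quotients of the free algebra\<close>

lemma scal_add: "scal (r + s) = (scal r + scal s :: ('k::field, 'a) free_poly)"
  by (simp add: scal_def single_add)

lemma scal_mult: "scal (r * s) = (scal r * scal s :: ('k::field, 'a) free_poly)"
  by (simp add: scal_def mult_single)

lemma scal_one [simp]: "scal 1 = (1 :: ('k::field, 'a) free_poly)"
  by (simp add: scal_def)

lemma scal_zero [simp]: "scal 0 = (0 :: ('k::field, 'a) free_poly)"
  by (simp add: scal_def)

lemma single_Cons_word:
  "Poly_Mapping.single (Word (x # w)) s = (var x * Poly_Mapping.single (Word w) s :: ('k::field, 'a) free_poly)"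
  by (simp add: var_def mult_single plus_free_word_def)

lemma scal_commute: "scal s * f = f * (scal s :: ('k::field, 'a) free_poly)"
proof -
  have 1: "scal s * Poly_Mapping.single w r = Poly_Mapping.single w r * (scal s :: ('k, 'a) free_poly)" for w r
    by (simp add: scal_def mult_single mult.commute)
  show ?thesis
    using subset_UNIV[of "Poly_Mapping.keys f"]
    by (induction f rule: poly_mapping_induct) (auto simp: distrib_left distrib_right 1)
qed

lemma carrier_free_algebra:
  "carrier (free_algebra X d) = {f. \<forall>w \<in> Poly_Mapping.keys f. set (letters w) \<subseteq> X}"
  by (simp add: free_algebra_def Let_def)

lemma free_algebra_simps [simp]:
  "mult (free_algebra X d) = (*)" "one (free_algebra X d) = 1"
  "zero (free_algebra X d) = 0" "add (free_algebra X d) = (+)"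
  "smult (free_algebra X d) = (\<lambda>c f. scal c * f)"
  by (simp_all add: free_algebra_def Let_def)

lemma hpart_free_algebra:
  "hpart (free_algebra X d) n = {f \<in> carrier (free_algebra X d).
     \<forall>w \<in> Poly_Mapping.keys f. sum_list (map d (letters w)) = n}"
  by (simp add: free_algebra_def Let_def)

lemma free_algebra_add_closed:
  "f \<in> carrier (free_algebra X d) \<Longrightarrow> g \<in> carrier (free_algebra X d) \<Longrightarrow> f + g \<in> carrier (free_algebra X d)"
  using keys_add[of f g] by (auto simp: carrier_free_algebra)

lemma free_algebra_mult_closed:
  assumes "f \<in> carrier (free_algebra X d)" "g \<in> carrier (free_algebra X d)"
  shows "f * g \<in> carrier (free_algebra X d)"
  unfolding carrier_free_algebra
proof (intro CollectI ballI)
  fix w assume "w \<in> Poly_Mapping.keys (f * g)"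
  then obtain u v where "w = u + v" "u \<in> Poly_Mapping.keys f" "v \<in> Poly_Mapping.keys g"
    using keys_mult[of f g] by auto
  then show "set (letters w) \<subseteq> X"
    using assms by (auto simp: carrier_free_algebra plus_free_word_def)
qed

lemma free_algebra_uminus_closed:
  "f \<in> carrier (free_algebra X d) \<Longrightarrow> - f \<in> carrier (free_algebra X d)"
  by (auto simp: carrier_free_algebra in_keys_iff)

lemma free_algebra_diff_closed:
  "f \<in> carrier (free_algebra X d) \<Longrightarrow> g \<in> carrier (free_algebra X d) \<Longrightarrow> f - g \<in> carrier (free_algebra X d)"
  using free_algebra_add_closed[of f X d "- g"] free_algebra_uminus_closed[of g X d] by simp

lemma scal_closed [simp]: "scal s \<in> carrier (free_algebra X d)"
  by (auto simp: carrier_free_algebra scal_def zero_free_word_def)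

lemma one_closed_free [simp]: "1 \<in> carrier (free_algebra X d)"
  using scal_closed[of 1 X d] by simp

lemma zero_closed_free [simp]: "0 \<in> carrier (free_algebra X d)"
  using scal_closed[of 0 X d] by simp

lemma var_closed: "x \<in> X \<Longrightarrow> var x \<in> carrier (free_algebra X d)"
  by (auto simp: carrier_free_algebra var_def)

lemma var_hpart: "x \<in> X \<Longrightarrow> var x \<in> hpart (free_algebra X d) (d x)"
  by (auto simp: hpart_free_algebra var_closed) (auto simp: var_def split: if_splits)

lemma scal_hpart: "scal s \<in> hpart (free_algebra X d) 0"
  by (auto simp: hpart_free_algebra) (auto simp: scal_def zero_free_word_def split: if_splits)

lemma free_algebra_ring: "ring (free_algebra X d)"
proof (rule ringI)
  show "abelian_group (free_algebra X d)"
  proof (rule abelian_groupI)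
    fix f assume "f \<in> carrier (free_algebra X d)"
    then show "\<exists>g\<in>carrier (free_algebra X d). g \<oplus>\<^bsub>free_algebra X d\<^esub> f = \<zero>\<^bsub>free_algebra X d\<^esub>"
      using free_algebra_uminus_closed by (intro bexI[of _ "- f"]) auto
  qed (auto simp: free_algebra_add_closed algebra_simps)
  show "Group.monoid (free_algebra X d)"
    by (rule monoidI) (auto simp: free_algebra_mult_closed algebra_simps)
qed (auto simp: algebra_simps)

lemma free_algebra_minus:
  assumes "f \<in> carrier (free_algebra X d)" "g \<in> carrier (free_algebra X d)"
  shows "f \<ominus>\<^bsub>free_algebra X d\<^esub> g = f - g"
proof -
  interpret ring "free_algebra X d" by (rule free_algebra_ring)
  have "\<ominus>\<^bsub>free_algebra X d\<^esub> g = - g"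
    by (rule minus_equality) (use assms free_algebra_uminus_closed in auto)
  then show ?thesis by (simp add: a_minus_def)
qed

lemma graded_quotient_simps:
  "carrier (graded_quotient F I) = carrier (F Quot I)" "mult (graded_quotient F I) = mult (F Quot I)"
  "one (graded_quotient F I) = one (F Quot I)" "zero (graded_quotient F I) = zero (F Quot I)"
  "add (graded_quotient F I) = add (F Quot I)"
  "smult (graded_quotient F I) = (\<lambda>c Y. (I +>\<^bsub>F\<^esub> (c \<odot>\<^bsub>F\<^esub> \<one>\<^bsub>F\<^esub>)) \<otimes>\<^bsub>F Quot I\<^esub> Y)"
  "hpart (graded_quotient F I) n = (\<lambda>f. I +>\<^bsub>F\<^esub> f) ` hpart F n"
  by (simp_all add: graded_quotient_def)

lemma graded_quotient_ring:
  assumes "ideal I F"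
  shows "ring (graded_quotient F I)"
proof -
  interpret R: ring "F Quot I" using assms by (rule ideal.quotient_is_ring)
  show ?thesis
  proof (rule ringI)
    show "abelian_group (graded_quotient F I)"
      by (rule abelian_groupI)
        (use R.l_neg R.a_inv_closed in \<open>auto simp: graded_quotient_simps R.a_ac simp del: mem_simps\<close>)
    show "Group.monoid (graded_quotient F I)"
      by (rule monoidI) (auto simp: graded_quotient_simps R.m_assoc)
  qed (auto simp: graded_quotient_simps R.l_distr R.r_distr)
qed

section \<open>Quotients of the free algebra and modules with a homogeneous basis\<close>

locale free_quotient =
  fixes X :: "'a set" and d :: "'a \<Rightarrow> nat" and I :: "('k::field, 'a) free_poly set"
  assumes ideal: "ideal I (free_algebra X d)"
begin

abbreviation "F \<equiv> free_algebra X d :: ('k, ('k, 'a) free_poly) graded"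
abbreviation "A \<equiv> graded_quotient F I"
abbreviation coset ("\<langle>_\<rangle>") where "\<langle>f\<rangle> \<equiv> I +>\<^bsub>F\<^esub> f"

sublocale ideal I F by (rule ideal)

lemma coset_closed [simp]: "f \<in> carrier F \<Longrightarrow> \<langle>f\<rangle> \<in> carrier A"
  using rcos_ring_hom by (simp add: ring_hom_def Pi_iff graded_quotient_simps)

lemma coset_add: "f \<in> carrier F \<Longrightarrow> g \<in> carrier F \<Longrightarrow> \<langle>f\<rangle> \<oplus>\<^bsub>A\<^esub> \<langle>g\<rangle> = \<langle>f + g\<rangle>"
  using rcos_ring_hom by (simp add: ring_hom_def graded_quotient_simps)

lemma coset_mult: "f \<in> carrier F \<Longrightarrow> g \<in> carrier F \<Longrightarrow> \<langle>f\<rangle> \<otimes>\<^bsub>A\<^esub> \<langle>g\<rangle> = \<langle>f * g\<rangle>"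
  using rcos_ring_hom by (simp add: ring_hom_def graded_quotient_simps)

lemma coset_one: "\<one>\<^bsub>A\<^esub> = \<langle>1\<rangle>"
  using rcos_ring_hom by (simp add: ring_hom_def graded_quotient_simps)

lemma coset_scalar: "s \<odot>\<^bsub>A\<^esub> \<one>\<^bsub>A\<^esub> = \<langle>scal s\<rangle>"
  using coset_mult[of "scal s" 1] coset_one by (simp add: graded_quotient_simps)

lemma coset_eq_iff: "f \<in> carrier F \<Longrightarrow> g \<in> carrier F \<Longrightarrow> \<langle>f\<rangle> = \<langle>g\<rangle> \<longleftrightarrow> f - g \<in> I"
  using quotient_eq_iff_same_a_r_cos[OF ideal, of f g] by (simp add: free_algebra_minus)

lemma carrier_quotient: "carrier A = (\<lambda>f. \<langle>f\<rangle>) ` carrier F"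
  by (auto simp: graded_quotient_simps FactRing_def A_RCOSETS_defs a_r_coset_def)

lemma quotient_ring: "ring A"
  by (rule graded_quotient_ring) (rule ideal)

end

text \<open>The component of degree \<open>n\<close> is the line spanned by \<open>v n\<close>. The
  basis is a parameter, so that a rescaled basis gives another instance over the same
  module.\<close>

locale based_module = free_quotient X d I
  for X :: "'a set" and d :: "'a \<Rightarrow> nat" and I :: "('k::field, 'a) free_poly set" +
  fixes V :: "(('k, 'a) free_poly set, 'v) graded" and v :: "nat \<Rightarrow> 'v"
  assumes graded: "graded_left_module A V"
    and basis_mem: "v n \<in> hpart V n"
    and basis: "x \<in> hpart V n \<Longrightarrow> \<exists>!s. x = kscale A V s (v n)"
begin

sublocale left_module A V
  using graded by (simp add: graded_left_module_def)

definition act where "act f x = \<langle>f\<rangle> \<odot>\<^bsub>V\<^esub> x"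

lemma hpart_closed: "x \<in> hpart V n \<Longrightarrow> x \<in> carrier V"
  using graded by (auto simp: graded_left_module_def dest: additive_subgroup.a_subset)

lemma v_closed [simp]: "v n \<in> carrier V"
  using basis_mem hpart_closed by blast

lemma act_closed [simp]: "f \<in> carrier F \<Longrightarrow> x \<in> carrier V \<Longrightarrow> act f x \<in> carrier V"
  by (simp add: act_def smult_closed)

lemma act_add_left:
  "f \<in> carrier F \<Longrightarrow> g \<in> carrier F \<Longrightarrow> x \<in> carrier V \<Longrightarrow> act (f + g) x = act f x \<oplus>\<^bsub>V\<^esub> act g x"
  using smult_l_distr[of "\<langle>f\<rangle>" "\<langle>g\<rangle>" x] by (simp add: act_def coset_add)

lemma act_add_right:
  "f \<in> carrier F \<Longrightarrow> x \<in> carrier V \<Longrightarrow> y \<in> carrier V \<Longrightarrow> act f (x \<oplus>\<^bsub>V\<^esub> y) = act f x \<oplus>\<^bsub>V\<^esub> act f y"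
  by (simp add: act_def smult_r_distr)

lemma act_mult:
  "f \<in> carrier F \<Longrightarrow> g \<in> carrier F \<Longrightarrow> x \<in> carrier V \<Longrightarrow> act (f * g) x = act f (act g x)"
  using smult_assoc1[of "\<langle>f\<rangle>" "\<langle>g\<rangle>" x] by (simp add: act_def coset_mult)

lemma act_one [simp]: "x \<in> carrier V \<Longrightarrow> act 1 x = x"
  using smult_one[of x] by (simp add: act_def coset_one)

lemma kscale_eq: "kscale A V s x = act (scal s) x"
  unfolding kscale_def coset_scalar act_def ..

lemma act_zero_right [simp]: "f \<in> carrier F \<Longrightarrow> act f \<zero>\<^bsub>V\<^esub> = \<zero>\<^bsub>V\<^esub>"
  using act_add_right[of f "\<zero>\<^bsub>V\<^esub>" "\<zero>\<^bsub>V\<^esub>"] M.add.r_cancel_one[of "act f \<zero>\<^bsub>V\<^esub>" "act f \<zero>\<^bsub>V\<^esub>"] by simp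

lemma act_zero_left [simp]: "x \<in> carrier V \<Longrightarrow> act 0 x = \<zero>\<^bsub>V\<^esub>"
  using act_add_left[of 0 0 x] M.add.r_cancel_one[of "act 0 x" "act 0 x"] by simp

lemma act_ideal: "f \<in> I \<Longrightarrow> x \<in> carrier V \<Longrightarrow> act f x = \<zero>\<^bsub>V\<^esub>"
  using act_zero_left[of x] a_Hcarr[of f] coset_eq_iff[of f 0] by (simp add: act_def)

lemma hpart_act: "f \<in> hpart F i \<Longrightarrow> x \<in> hpart V j \<Longrightarrow> act f x \<in> hpart V (i + j)"
  using graded by (fastforce simp: graded_left_module_def act_def graded_quotient_simps)

lemma hpart_eq: "hpart V n = {act (scal s) (v n) | s. True}"
proof
  show "hpart V n \<subseteq> {act (scal s) (v n) | s. True}"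
    using basis unfolding kscale_eq by blast
  show "{act (scal s) (v n) | s. True} \<subseteq> hpart V n"
    using hpart_act[OF scal_hpart basis_mem, of _ n] by auto
qed

lemma scal_v_inject: "act (scal s) (v n) = act (scal t) (v n) \<longleftrightarrow> s = t"
proof
  have "act (scal s) (v n) \<in> hpart V n" by (auto simp: hpart_eq)
  from basis[OF this] show "act (scal s) (v n) = act (scal t) (v n) \<Longrightarrow> s = t"
    unfolding kscale_eq by blast
qed simp

lemma scal_v_zero_iff: "act (scal s) (v n) = \<zero>\<^bsub>V\<^esub> \<longleftrightarrow> s = 0"
  using scal_v_inject[of s n 0] by simp

lemma decomposition:
  assumes "x \<in> carrier V"
  shows "\<exists>!f. (\<forall>n. f n \<in> hpart V n) \<and> finite {n. f n \<noteq> \<zero>\<^bsub>V\<^esub>} \<and> x = finsum V f {n. f n \<noteq> \<zero>\<^bsub>V\<^esub>}"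
  using graded assms by (simp add: graded_left_module_def)

definition lincomb :: "(nat \<Rightarrow>\<^sub>0 'k) \<Rightarrow> 'v" where
  "lincomb h = finsum V (\<lambda>n. act (scal (Poly_Mapping.lookup h n)) (v n)) (Poly_Mapping.keys h)"

lemma lincomb_closed [simp]: "lincomb h \<in> carrier V"
  by (auto simp: lincomb_def intro!: M.finsum_closed)

lemma lincomb_superset:
  assumes "finite S" "Poly_Mapping.keys h \<subseteq> S"
  shows "lincomb h = finsum V (\<lambda>n. act (scal (Poly_Mapping.lookup h n)) (v n)) S"
  unfolding lincomb_def
  by (rule M.add.finprod_mono_neutral_cong_left) (use assms in \<open>auto simp: in_keys_iff\<close>)

lemma lincomb_add: "lincomb (g + h) = lincomb g \<oplus>\<^bsub>V\<^esub> lincomb h"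
proof -
  let ?S = "Poly_Mapping.keys g \<union> Poly_Mapping.keys h"
  have "lincomb (g + h) = finsum V (\<lambda>n. act (scal (Poly_Mapping.lookup (g + h) n)) (v n)) ?S"
    using keys_add[of g h] by (intro lincomb_superset) auto
  also have "\<dots> = finsum V (\<lambda>n. act (scal (Poly_Mapping.lookup g n)) (v n) \<oplus>\<^bsub>V\<^esub> act (scal (Poly_Mapping.lookup h n)) (v n)) ?S"
    by (intro M.add.finprod_cong') (auto simp: lookup_add scal_add act_add_left)
  also have "\<dots> = finsum V (\<lambda>n. act (scal (Poly_Mapping.lookup g n)) (v n)) ?S \<oplus>\<^bsub>V\<^esub>
      finsum V (\<lambda>n. act (scal (Poly_Mapping.lookup h n)) (v n)) ?S"
    by (rule M.finsum_addf) auto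
  also have "\<dots> = lincomb g \<oplus>\<^bsub>V\<^esub> lincomb h"
    using lincomb_superset[of ?S g] lincomb_superset[of ?S h] by simp
  finally show ?thesis .
qed

lemma lincomb_single: "lincomb (Poly_Mapping.single n s) = act (scal s) (v n)"
  using lincomb_superset[of "{n}" "Poly_Mapping.single n s"] by simp

lemma lincomb_zero [simp]: "lincomb 0 = \<zero>\<^bsub>V\<^esub>"
  by (simp add: lincomb_def)

text \<open>Both halves come from the homogeneous decomposition: its uniqueness recovers the
  coefficients of a linear combination, and its existence writes every element as one, each
  component being a line.\<close>

lemma lincomb_bij: "bij_betw lincomb UNIV (carrier V)"
proof -
  define coef where "coef x = (THE f. (\<forall>n. f n \<in> hpart V n) \<and> finite {n. f n \<noteq> \<zero>\<^bsub>V\<^esub>} \<and>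
    x = finsum V f {n. f n \<noteq> \<zero>\<^bsub>V\<^esub>})" for x
  have keys: "{n. act (scal (Poly_Mapping.lookup h n)) (v n) \<noteq> \<zero>\<^bsub>V\<^esub>} = Poly_Mapping.keys h" for h :: "nat \<Rightarrow>\<^sub>0 'k"
    by (auto simp: scal_v_zero_iff in_keys_iff)
  have coef: "coef (lincomb h) = (\<lambda>n. act (scal (Poly_Mapping.lookup h n)) (v n))" for h
    unfolding coef_def
    by (rule the1_equality[OF decomposition]) (auto simp: keys lincomb_def hpart_eq)
  have "inj lincomb"
  proof (rule injI)
    fix g h assume "lincomb g = lincomb h"
    then have "(\<lambda>n. act (scal (Poly_Mapping.lookup g n)) (v n)) = (\<lambda>n. act (scal (Poly_Mapping.lookup h n)) (v n))"
      by (metis coef)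
    then show "g = h" by (intro poly_mapping_eqI) (metis scal_v_inject)
  qed
  moreover have "x \<in> range lincomb" if x: "x \<in> carrier V" for x
  proof -
    obtain f where f: "\<forall>n. f n \<in> hpart V n" "finite {n. f n \<noteq> \<zero>\<^bsub>V\<^esub>}" "x = finsum V f {n. f n \<noteq> \<zero>\<^bsub>V\<^esub>}"
      using decomposition[OF x] by auto
    then have "\<forall>n. \<exists>s. f n = act (scal s) (v n)" by (auto simp: hpart_eq)
    then obtain s where s: "f = (\<lambda>n. act (scal (s n)) (v n))" by metis
    then have fin: "finite {n. s n \<noteq> 0}" using f(2) by (simp add: scal_v_zero_iff)
    then have "Poly_Mapping.lookup (Abs_poly_mapping s) = s" by (simp add: lookup_Abs_poly_mapping)
    then have "lincomb (Abs_poly_mapping s) = finsum V f {n. f n \<noteq> \<zero>\<^bsub>V\<^esub>}"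
      unfolding lincomb_def keys[symmetric] by (simp add: s)
    then show ?thesis using f(3) by (metis rangeI)
  qed
  ultimately show ?thesis by (auto simp: bij_betw_def)
qed

text \<open>In the basis \<open>v\<close> the module is the shift representation with its own
  structure constants. Both sides are additive in \<open>f\<close> and \<open>h\<close>, so it
  suffices to compare a word on a basis vector, by induction on the word; scalars can be moved past
  everything because they are central in the free algebra.\<close>

lemma lincomb_act:
  assumes c: "\<And>x n. x \<in> X \<Longrightarrow> act (var x) (v n) = act (scal (c x n)) (v (n + d x))"
    and f: "f \<in> carrier F"
  shows "lincomb (shift_act d c f h) = act f (lincomb h)"
proof -
  have comm: "act f (act (scal s) x) = act (scal s) (act f x)"
    if "f \<in> carrier F" "x \<in> carrier V" for f s x
    using that act_mult[of f "scal s" x] act_mult[of "scal s" f x] by (simp add: scal_commute)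
  have word: "Poly_Mapping.single (Word w) s \<in> carrier F" if "set w \<subseteq> X" for w s
    using that by (auto simp: carrier_free_algebra)
  have 1: "act (Poly_Mapping.single (Word w) s) (v n) =
      act (scal (s * weight d c w n)) (v (n + sum_list (map d w)))" if "set w \<subseteq> X" for w s n
    using that
  proof (induction w)
    case Nil
    then show ?case by (simp add: scal_def zero_free_word_def)
  next
    case (Cons x w)
    have x: "var x \<in> carrier F" using Cons.prems by (simp add: var_closed)
    have "act (Poly_Mapping.single (Word (x # w)) s) (v n) = act (var x) (act (Poly_Mapping.single (Word w) s) (v n))"
      unfolding single_Cons_word using x Cons.prems word by (intro act_mult) auto
    also have "\<dots> = act (var x) (act (scal (s * weight d c w n)) (v (n + sum_list (map d w))))"
      using Cons by simp
    also have "\<dots> = act (scal (s * weight d c w n)) (act (scal (c x (n + sum_list (map d w)))) (v (n + sum_list (map d w) + d x)))"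
      using comm[OF x] c Cons.prems by simp
    also have "\<dots> = act (scal (s * weight d c w n) * scal (c x (n + sum_list (map d w)))) (v (n + sum_list (map d w) + d x))"
      by (simp add: act_mult)
    finally show ?case by (simp add: algebra_simps flip: scal_mult)
  qed
  have 2: "lincomb (shift_act d c (Poly_Mapping.single w s) (Poly_Mapping.single n t)) =
      act (Poly_Mapping.single w s) (lincomb (Poly_Mapping.single n t))" if "set (letters w) \<subseteq> X" for w s n t
    using 1[OF that, of s n] comm[OF word[OF that, of s], of "v n" t]
      act_mult[of "scal t" "scal (s * weight d c (letters w) n)" "v (n + sum_list (map d (letters w)))"]
    by (simp add: shift_act_single lincomb_single mult.commute flip: scal_mult)
  have 3: "lincomb (shift_act d c (Poly_Mapping.single w s) h) =
      act (Poly_Mapping.single w s) (lincomb h)" if "set (letters w) \<subseteq> X" for w s h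
    using subset_UNIV[of "Poly_Mapping.keys h"]
    by (induction h rule: poly_mapping_induct)
      (use that 2 word[OF that] in \<open>auto simp: shift_act_add_right lincomb_add act_add_right\<close>)
  have "Poly_Mapping.keys f \<subseteq> {w. set (letters w) \<subseteq> X}"
    using f by (auto simp: carrier_free_algebra)
  then show ?thesis
  proof (induction f rule: poly_mapping_induct)
    case (add w s g)
    then have "Poly_Mapping.single w s \<in> carrier F" "g \<in> carrier F"
      by (auto simp: carrier_free_algebra split: if_splits)
    then show ?case using add 3 by (simp add: shift_act_add_left lincomb_add act_add_left)
  qed simp
qed

end

section \<open>Modules determined by their structure constants, and modules built from them\<close>

context based_module
begin

lemma carrier_lincomb: "x \<in> carrier V \<Longrightarrow> \<exists>h. x = lincomb h"
  using lincomb_bij by (metis bij_betw_imp_surj_on imageE)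

lemma lincomb_inject: "lincomb g = lincomb h \<longleftrightarrow> g = h"
  using lincomb_bij by (auto simp: bij_betw_def inj_on_def)

text \<open>The passage from relations in the algebra to equations between structure constants: the
  ideal kills the module, and coordinates are unique.\<close>

lemma shift_act_ideal:
  assumes "\<And>x n. x \<in> X \<Longrightarrow> act (var x) (v n) = act (scal (c x n)) (v (n + d x))" and "f \<in> I"
  shows "shift_act d c f h = 0"
proof -
  have "lincomb (shift_act d c f h) = lincomb 0"
    using lincomb_act[of c f h] act_ideal[of f "lincomb h"] assms a_Hcarr by simp
  then show ?thesis by (simp only: lincomb_inject)
qed

end

text \<open>Equal structure constants make both modules copies of one shift representation; the
  isomorphism keeps the coordinates and replaces one basis by the other.\<close>

lemma based_module_iso:
  assumes V: "based_module X d I V v" and W: "based_module X d I W w"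
    and cV: "\<And>x n. x \<in> X \<Longrightarrow> (I +>\<^bsub>free_algebra X d\<^esub> var x) \<odot>\<^bsub>V\<^esub> v n =
      kscale (graded_quotient (free_algebra X d) I) V (c x n) (v (n + d x))"
    and cW: "\<And>x n. x \<in> X \<Longrightarrow> (I +>\<^bsub>free_algebra X d\<^esub> var x) \<odot>\<^bsub>W\<^esub> w n =
      kscale (graded_quotient (free_algebra X d) I) W (c x n) (w (n + d x))"
  shows "\<exists>f. graded_iso (graded_quotient (free_algebra X d) I) V W f"
proof -
  interpret V: based_module X d I V v by (rule V)
  interpret W: based_module X d I W w by (rule W)
  have cV': "x \<in> X \<Longrightarrow> V.act (var x) (v n) = V.act (scal (c x n)) (v (n + d x))" for x n
    using cV by (simp add: V.act_def V.kscale_eq)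
  have cW': "x \<in> X \<Longrightarrow> W.act (var x) (w n) = W.act (scal (c x n)) (w (n + d x))" for x n
    using cW by (simp add: W.act_def W.kscale_eq)
  let ?f = "W.lincomb \<circ> inv_into UNIV V.lincomb"
  have f: "?f (V.lincomb h) = W.lincomb h" for h
    using V.lincomb_bij by (simp add: bij_betw_def inv_f_f)
  have "bij_betw ?f (carrier V) (carrier W)"
    using V.lincomb_bij W.lincomb_bij by (meson bij_betw_inv_into bij_betw_trans)
  moreover have "?f (x \<oplus>\<^bsub>V\<^esub> y) = ?f x \<oplus>\<^bsub>W\<^esub> ?f y" if x: "x \<in> carrier V" and y: "y \<in> carrier V" for x y
  proof -
    obtain g h where gh: "x = V.lincomb g" "y = V.lincomb h"
      using V.carrier_lincomb[OF x] V.carrier_lincomb[OF y] by auto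
    show ?thesis by (simp only: gh f W.lincomb_add flip: V.lincomb_add)
  qed
  moreover have "?f (a \<odot>\<^bsub>V\<^esub> x) = a \<odot>\<^bsub>W\<^esub> ?f x" if a: "a \<in> carrier V.A" and x: "x \<in> carrier V" for a x
  proof -
    obtain h where h: "x = V.lincomb h" using V.carrier_lincomb[OF x] by auto
    obtain p where p: "p \<in> carrier V.F" "a = V.coset p" using a V.carrier_quotient by auto
    have "a \<odot>\<^bsub>V\<^esub> x = V.lincomb (shift_act d c p h)"
      using V.lincomb_act[OF cV' p(1)] h p by (simp add: V.act_def)
    moreover have "a \<odot>\<^bsub>W\<^esub> W.lincomb h = W.lincomb (shift_act d c p h)"
      using W.lincomb_act[OF cW' p(1)] p by (simp add: W.act_def)
    ultimately show ?thesis by (simp only: f h)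
  qed
  moreover have "?f ` hpart V n \<subseteq> hpart W n" for n
  proof
    fix y assume "y \<in> ?f ` hpart V n"
    then obtain s where "y = ?f (V.lincomb (Poly_Mapping.single n s))"
      by (auto simp: V.hpart_eq V.lincomb_single)
    then show "y \<in> hpart W n" using f[of "Poly_Mapping.single n s"]
      by (auto simp: W.hpart_eq W.lincomb_single)
  qed
  ultimately show ?thesis unfolding graded_iso_def by blast
qed

text \<open>The choice of a representative of the coset is irrelevant if \<open>I\<close> acts by zero.\<close>

definition (in free_quotient) shift_module ::
  "((nat \<Rightarrow>\<^sub>0 'k) \<Rightarrow> 'v) \<Rightarrow> ('a \<Rightarrow> nat \<Rightarrow> 'k) \<Rightarrow> (('k, 'a) free_poly set, 'v) graded" where
  "shift_module emb c = \<lparr>carrier = range emb, mult = undefined, one = undefined, zero = emb 0,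
     add = (\<lambda>x y. emb (inv_into UNIV emb x + inv_into UNIV emb y)),
     smult = (\<lambda>Y x. emb (shift_act d c (SOME f. f \<in> carrier F \<and> \<langle>f\<rangle> = Y) (inv_into UNIV emb x))),
     hpart = (\<lambda>n. emb ` {h. Poly_Mapping.keys h \<subseteq> {n}})\<rparr>"

text \<open>The converse construction, for the surjectivity of the parametrization. The injection
  \<open>emb\<close> moves the sequence space into the prescribed universe \<open>'v\<close>, and
  \<open>vanish\<close> lets the action pass to the quotient algebra.\<close>

locale shift_model = free_quotient X d I
  for X :: "'a set" and d :: "'a \<Rightarrow> nat" and I :: "('k::field, 'a) free_poly set" +
  fixes emb :: "(nat \<Rightarrow>\<^sub>0 'k) \<Rightarrow> 'v" and c :: "'a \<Rightarrow> nat \<Rightarrow> 'k"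
  assumes inj: "inj emb" and vanish: "f \<in> I \<Longrightarrow> shift_act d c f h = 0"
begin

abbreviation "M \<equiv> shift_module emb c"

lemma simps [simp]:
  "carrier M = range emb" "zero M = emb 0" "emb g \<oplus>\<^bsub>M\<^esub> emb h = emb (g + h)"
  "hpart M n = emb ` {h. Poly_Mapping.keys h \<subseteq> {n}}"
  using inj by (simp_all add: shift_module_def)

lemma smult [simp]:
  assumes "f \<in> carrier F"
  shows "\<langle>f\<rangle> \<odot>\<^bsub>M\<^esub> emb h = emb (shift_act d c f h)"
proof -
  define g where "g = (SOME g. g \<in> carrier F \<and> \<langle>g\<rangle> = \<langle>f\<rangle>)"
  have "g \<in> carrier F \<and> \<langle>g\<rangle> = \<langle>f\<rangle>"
    unfolding g_def by (rule someI[of _ f]) (use assms in simp)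
  then have "shift_act d c (g - f) h = 0" using assms coset_eq_iff vanish by blast
  then show ?thesis
    using inj by (simp add: shift_module_def shift_act_diff flip: g_def)
qed

lemma abelian_group_M: "abelian_group M"
proof (rule abelian_groupI)
  fix x assume "x \<in> carrier M"
  then obtain h where "x = emb h" by auto
  then show "\<exists>y\<in>carrier M. y \<oplus>\<^bsub>M\<^esub> x = \<zero>\<^bsub>M\<^esub>" by (intro bexI[of _ "emb (- h)"]) auto
qed (auto simp: add_ac)

lemma left_module_M: "left_module A M"
proof (intro left_module.intro left_module_axioms.intro quotient_ring abelian_group_M)
qed (auto simp: carrier_quotient coset_add coset_mult coset_one free_algebra_add_closed
  free_algebra_mult_closed shift_act_add_left shift_act_add_right shift_act_mult)

lemma kscale_M: "kscale A M s (emb (Poly_Mapping.single n t)) = emb (Poly_Mapping.single n (s * t))"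
  by (simp add: kscale_def coset_scalar shift_act_scal_single)

lemma finsum_M: "finite S \<Longrightarrow> finsum M (\<lambda>n. emb (g n)) S = emb (\<Sum>n\<in>S. g n)"
proof (induction S rule: finite_induct)
  interpret abelian_group M by (rule abelian_group_M)
  {
    case empty
    then show ?case by simp
  next
    case (insert n S)
    then show ?case by (subst finsum_insert) auto
  }
qed

lemma keys_subset_single: "Poly_Mapping.keys h \<subseteq> {n} \<longleftrightarrow> (\<exists>s. h = Poly_Mapping.single n s)"
proof
  assume "Poly_Mapping.keys h \<subseteq> {n}"
  then have "h = Poly_Mapping.single n (Poly_Mapping.lookup h n)"
    by (intro poly_mapping_eqI) (auto simp: lookup_single when_def in_keys_iff)
  then show "\<exists>s. h = Poly_Mapping.single n s" by blast
qed (auto split: if_splits)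

lemma decomposition_M:
  "\<exists>!f. (\<forall>n. f n \<in> hpart M n) \<and> finite {n. f n \<noteq> \<zero>\<^bsub>M\<^esub>} \<and> emb h = finsum M f {n. f n \<noteq> \<zero>\<^bsub>M\<^esub>}"
proof (rule ex_ex1I)
  have inj': "emb g = emb h \<longleftrightarrow> g = h" for g h using inj by (auto simp: inj_def)
  have nz: "{n. emb (Poly_Mapping.single n (s n)) \<noteq> \<zero>\<^bsub>M\<^esub>} = {n. s n \<noteq> 0}" for s
    by (auto simp: inj') (metis lookup_single_eq lookup_zero)
  have sum: "Poly_Mapping.lookup (\<Sum>n | s n \<noteq> 0. Poly_Mapping.single n (s n)) m = s m"
    if "finite {n. s n \<noteq> 0}" for s :: "nat \<Rightarrow> 'k" and m
    using that by (auto simp: lookup_sum lookup_single when_def)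
  show "\<exists>f. (\<forall>n. f n \<in> hpart M n) \<and> finite {n. f n \<noteq> \<zero>\<^bsub>M\<^esub>} \<and> emb h = finsum M f {n. f n \<noteq> \<zero>\<^bsub>M\<^esub>}"
    by (intro exI[of _ "\<lambda>n. emb (Poly_Mapping.single n (Poly_Mapping.lookup h n))"] conjI)
      (auto simp: nz finsum_M inj' keys_subset_single sum intro!: poly_mapping_eqI simp del: simps(2))
  fix f f'
  assume f: "(\<forall>n. f n \<in> hpart M n) \<and> finite {n. f n \<noteq> \<zero>\<^bsub>M\<^esub>} \<and> emb h = finsum M f {n. f n \<noteq> \<zero>\<^bsub>M\<^esub>}"
    and f': "(\<forall>n. f' n \<in> hpart M n) \<and> finite {n. f' n \<noteq> \<zero>\<^bsub>M\<^esub>} \<and> emb h = finsum M f' {n. f' n \<noteq> \<zero>\<^bsub>M\<^esub>}"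
  have unique: "f = (\<lambda>n. emb (Poly_Mapping.single n (Poly_Mapping.lookup h n)))"
    if f: "(\<forall>n. f n \<in> hpart M n) \<and> finite {n. f n \<noteq> \<zero>\<^bsub>M\<^esub>} \<and> emb h = finsum M f {n. f n \<noteq> \<zero>\<^bsub>M\<^esub>}"
    for f
  proof -
    have "\<forall>n. \<exists>s. f n = emb (Poly_Mapping.single n s)" using f by (auto simp: keys_subset_single)
    then obtain s where s: "f = (\<lambda>n. emb (Poly_Mapping.single n (s n)))" by metis
    have fin: "finite {n. s n \<noteq> 0}"
      and "emb h = finsum M (\<lambda>n. emb (Poly_Mapping.single n (s n))) {n. s n \<noteq> 0}"
      using f unfolding s nz by auto
    then have "h = (\<Sum>n | s n \<noteq> 0. Poly_Mapping.single n (s n))" by (simp add: finsum_M inj')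
    then show ?thesis using sum[OF fin] by (simp add: s)
  qed
  show "f = f'" using unique[OF f] unique[OF f'] by simp
qed

lemma graded_left_module_M: "graded_left_module A M"
  unfolding graded_left_module_def
proof (intro conjI allI ballI left_module_M)
  fix n
  interpret abelian_group M by (rule abelian_group_M)
  show "additive_subgroup (hpart M n) M"
  proof (intro additive_subgroup.intro add.subgroupI)
    fix x assume "x \<in> hpart M n"
    then obtain h where h: "Poly_Mapping.keys h \<subseteq> {n}" "x = emb h" by auto
    have "\<ominus>\<^bsub>M\<^esub> x = emb (- h)" by (rule minus_equality) (auto simp: h)
    then show "\<ominus>\<^bsub>M\<^esub> x \<in> hpart M n" using h(1) by (auto simp: in_keys_iff subset_iff)
  next
    fix x y assume "x \<in> hpart M n" "y \<in> hpart M n"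
    then obtain g h where h: "x = emb g" "y = emb h"  "Poly_Mapping.keys g \<subseteq> {n}" "Poly_Mapping.keys h \<subseteq> {n}"
      by auto
    then have "Poly_Mapping.keys (g + h) \<subseteq> {n}" using keys_add[of g h] by blast
    then show "x \<oplus>\<^bsub>M\<^esub> y \<in> hpart M n" using h by auto
  qed (auto intro: exI[of _ 0])
next
  fix i j a x assume "a \<in> hpart A i" "x \<in> hpart M j"
  then obtain f h where "f \<in> hpart F i" "a = \<langle>f\<rangle>" "x = emb h" "Poly_Mapping.keys h \<subseteq> {j}"
    by (auto simp: graded_quotient_simps)
  then show "a \<odot>\<^bsub>M\<^esub> x \<in> hpart M (i + j)"
    using keys_shift_act[of f d i h j c] by (auto simp: hpart_free_algebra)
next
  fix x assume "x \<in> carrier M"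
  then obtain h where h: "x = emb h" by auto
  show "\<exists>!f. (\<forall>n. f n \<in> hpart M n) \<and> finite {n. f n \<noteq> \<zero>\<^bsub>M\<^esub>} \<and> x = finsum M f {n. f n \<noteq> \<zero>\<^bsub>M\<^esub>}"
    unfolding h by (rule decomposition_M)
qed

lemma point_module_M:
  assumes cyclic: "\<And>h. \<exists>f\<in>carrier F. shift_act d c f (Poly_Mapping.single 0 1) = h"
  shows "point_module A M"
  unfolding point_module_def
proof (intro conjI allI graded_left_module_M)
  have "carrier M \<subseteq> (\<lambda>a. a \<odot>\<^bsub>M\<^esub> emb (Poly_Mapping.single 0 1)) ` carrier A"
  proof
    fix x assume "x \<in> carrier M"
    then obtain h where "x = emb h" by auto
    with cyclic[of h] obtain f where "f \<in> carrier F" "x = emb (shift_act d c f (Poly_Mapping.single 0 1))" by auto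
    then show "x \<in> (\<lambda>a. a \<odot>\<^bsub>M\<^esub> emb (Poly_Mapping.single 0 1)) ` carrier A"
      by (intro image_eqI[of _ _ "\<langle>f\<rangle>"]) simp_all
  qed
  moreover have "(\<lambda>a. a \<odot>\<^bsub>M\<^esub> emb (Poly_Mapping.single 0 1)) ` carrier A \<subseteq> carrier M"
    by (auto simp: carrier_quotient)
  ultimately show "\<exists>v\<in>hpart M 0. carrier M = (\<lambda>a. a \<odot>\<^bsub>M\<^esub> v) ` carrier A"
    by (intro bexI[of _ "emb (Poly_Mapping.single 0 1)"]) auto
next
  fix n
  have "\<exists>!s. x = kscale A M s (emb (Poly_Mapping.single n 1))" if x: "x \<in> hpart M n" for x
  proof -
    obtain s where "x = emb (Poly_Mapping.single n s)"
      using x by (auto simp: keys_subset_single)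
    then show ?thesis using inj
      by (auto simp: kscale_M inj_eq dest: arg_cong[of _ _ "\<lambda>h. Poly_Mapping.lookup h n"])
  qed
  then show "\<exists>v\<in>hpart M n. \<forall>x\<in>hpart M n. \<exists>!s. x = kscale A M s v"
    by (intro bexI[of _ "emb (Poly_Mapping.single n 1)"] ballI) auto
qed

end

section \<open>Annihilators and cyclicity of shift representations\<close>

lemma shift_act_eq_0I:
  assumes "\<And>n. shift_act d c f (Poly_Mapping.single n 1) = 0"
  shows "shift_act d c f h = 0"
proof -
  have 1: "shift_act d c f (Poly_Mapping.single n s) = 0" for n s
  proof -
    have "shift_act d c f (Poly_Mapping.single n s) = shift_act d c (f * scal s) (Poly_Mapping.single n 1)"
      by (simp add: shift_act_mult shift_act_scal_single)
    also have "\<dots> = 0" by (simp add: shift_act_mult assms flip: scal_commute)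
    finally show ?thesis .
  qed
  show ?thesis
    using subset_UNIV[of "Poly_Mapping.keys h"]
    by (induction h rule: poly_mapping_induct) (auto simp: shift_act_add_right 1)
qed

text \<open>The annihilator of a module is a two-sided ideal, so it contains the ideal generated by
  any set of elements that act by zero.\<close>

lemma (in free_quotient) shift_act_genideal:
  assumes "R \<subseteq> carrier F" and "\<And>f h. f \<in> R \<Longrightarrow> shift_act d c f h = 0" and f: "f \<in> Idl\<^bsub>F\<^esub> R"
  shows "shift_act d c f h = 0"
proof -
  let ?J = "{f \<in> carrier F. \<forall>h. shift_act d c f h = 0}"
  have "ideal ?J F"
  proof (rule idealI)
    show "subgroup ?J (add_monoid F)"
    proof (rule add.subgroupI)
      fix f assume f: "f \<in> ?J"
      then have "\<ominus>\<^bsub>F\<^esub> f = - f"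
        by (intro minus_equality) (auto simp: free_algebra_uminus_closed)
      then show "\<ominus>\<^bsub>F\<^esub> f \<in> ?J" using f by (simp add: free_algebra_uminus_closed shift_act_uminus)
    qed (auto simp: free_algebra_add_closed shift_act_add_left intro: exI[of _ 0])
  qed (auto simp: free_algebra_ring free_algebra_mult_closed shift_act_mult)
  then have "Idl\<^bsub>F\<^esub> R \<subseteq> ?J" using assms(1,2) by (intro genideal_minimal) auto
  then show ?thesis using f by auto
qed

text \<open>A path that starts in degree at most \<open>n\<close> and ends beyond \<open>n\<close>
  has a letter that jumps across this border. If all such letters have coefficient 0, the product
  along the path is 0.\<close>

lemma weight_eq_0:
  assumes "\<And>x m. x \<in> X \<Longrightarrow> m \<le> n \<Longrightarrow> n < m + d x \<Longrightarrow> c x m = 0"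
    and "set w \<subseteq> X" "m \<le> n" "n < m + sum_list (map d w)"
  shows "weight d c w m = 0"
  using assms(2-)
proof (induction w)
  case (Cons x w)
  then show ?case
    \<comment> \<open>Either the tail, which acts first, has already crossed the border, or the head
      letter does.\<close>
    using assms(1)[of x "m + sum_list (map d w)"] by (cases "n < m + sum_list (map d w)") (auto simp: add_ac)
qed simp

lemma lookup_shift_act_eq_0:
  assumes "\<And>x m. x \<in> X \<Longrightarrow> m \<le> n \<Longrightarrow> n < m + d x \<Longrightarrow> c x m = 0"
    and "f \<in> carrier (free_algebra X d)"
  shows "Poly_Mapping.lookup (shift_act d c f (Poly_Mapping.single 0 s)) (Suc n) = 0"
  unfolding shift_act_def lookup_sum
proof (intro sum.neutral ballI)
  fix w and m :: nat assume "w \<in> Poly_Mapping.keys f" "m \<in> Poly_Mapping.keys (Poly_Mapping.single 0 s)"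
  then have "m = 0" "set (letters w) \<subseteq> X"
    using assms(2) by (auto simp: carrier_free_algebra split: if_splits)
  moreover have "weight d c (letters w) 0 = 0" if "sum_list (map d (letters w)) = Suc n"
    by (rule weight_eq_0[of X n d c]) (use assms(1) calculation that in auto)
  ultimately show "Poly_Mapping.lookup (Poly_Mapping.single (m + sum_list (map d (letters w)))
      (Poly_Mapping.lookup f w * weight d c (letters w) m * Poly_Mapping.lookup (Poly_Mapping.single 0 s) m)) (Suc n) = 0"
    by (auto simp: lookup_single when_def)
qed

text \<open>The basis vector of degree 0 generates: in each degree some letter of degree 1 acts by a
  nonzero constant, and dividing by it climbs one degree.\<close>

lemma shift_act_cyclic:
  assumes "\<And>n. \<exists>x\<in>X. d x = 1 \<and> c x n \<noteq> 0"
  shows "\<exists>f\<in>carrier (free_algebra X d). shift_act d c f (Poly_Mapping.single 0 1) = h"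
proof -
  have 1: "\<exists>f\<in>carrier (free_algebra X d). shift_act d c f (Poly_Mapping.single 0 1) = Poly_Mapping.single n s" for n s
  proof (induction n arbitrary: s)
    case 0
    show ?case
      using shift_act_scal_single[of d c s 0 1] by (intro bexI[of _ "scal s"]) simp_all
  next
    case (Suc n)
    obtain x where x: "x \<in> X" "d x = 1" "c x n \<noteq> 0" using assms by blast
    obtain f where "f \<in> carrier (free_algebra X d)"
      "shift_act d c f (Poly_Mapping.single 0 1) = Poly_Mapping.single n (s / c x n)"
      using Suc by blast
    then show ?case using x
      by (intro bexI[of _ "var x * f"]) (auto simp: shift_act_mult shift_act_var_single free_algebra_mult_closed var_closed)
  qed
  show ?thesis
    using subset_UNIV[of "Poly_Mapping.keys h"]
  proof (induction h rule: poly_mapping_induct)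
    case zero
    then show ?case by (intro bexI[of _ 0]) auto
  next
    case (add n s h)
    then obtain f where "f \<in> carrier (free_algebra X d)" "shift_act d c f (Poly_Mapping.single 0 1) = h" by blast
    moreover obtain g where "g \<in> carrier (free_algebra X d)"
      "shift_act d c g (Poly_Mapping.single 0 1) = Poly_Mapping.single n s" using 1 by blast
    ultimately show ?case
      by (intro bexI[of _ "g + f"]) (auto simp: shift_act_add_left free_algebra_add_closed)
  qed
qed

section \<open>Change of the homogeneous basis\<close>

context based_module
begin

lemma act_scal_mult: "x \<in> carrier V \<Longrightarrow> act (scal (s * t)) x = act (scal s) (act (scal t) x)"
  by (simp add: scal_mult act_mult)

lemma rescale:
  assumes "\<And>n. \<mu> n \<noteq> 0"
  shows "based_module X d I V (\<lambda>n. act (scal (\<mu> n)) (v n))"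
proof
  show "act (scal (\<mu> n)) (v n) \<in> hpart V n" for n by (auto simp: hpart_eq)
  fix x n assume "x \<in> hpart V n"
  then obtain s where s: "x = act (scal s) (v n)" by (auto simp: hpart_eq)
  have "kscale A V t (act (scal (\<mu> n)) (v n)) = act (scal (t * \<mu> n)) (v n)" for t
    by (simp add: kscale_eq act_mult scal_mult)
  then show "\<exists>!t. x = kscale A V t (act (scal (\<mu> n)) (v n))"
    using assms[of n] by (intro ex1I[of _ "s / \<mu> n"]) (auto simp: s scal_v_inject)
qed (rule graded)

lemma consts_exist:
  "\<exists>c. \<forall>x\<in>X. \<forall>n. act (var x) (v n) = act (scal (c x n)) (v (n + d x))"
proof -
  have "\<exists>s. act (var x) (v n) = act (scal s) (v (n + d x))" if "x \<in> X" for x n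
    using hpart_act[OF var_hpart[OF that] basis_mem[of n]] by (auto simp: hpart_eq add.commute)
  then show ?thesis by metis
qed

lemma based_module_nonzero:
  assumes w: "\<And>n. w n \<in> hpart V n" "\<And>n. w n \<noteq> \<zero>\<^bsub>V\<^esub>"
  shows "based_module X d I V w"
proof -
  have "\<forall>n. \<exists>s. w n = act (scal s) (v n)" using w(1) by (auto simp: hpart_eq)
  then obtain \<mu> where \<mu>: "w = (\<lambda>n. act (scal (\<mu> n)) (v n))" by metis
  then have "\<mu> n \<noteq> 0" for n using w(2)[of n] by (auto simp: scal_v_zero_iff)
  then show ?thesis using rescale \<mu> by simp
qed

lemma rescale_act:
  assumes "f \<in> carrier F" "act f (v n) = act (scal s) (v m)" "s * \<mu> n = t * \<mu> m"
  shows "act f (act (scal (\<mu> n)) (v n)) = act (scal t) (act (scal (\<mu> m)) (v m))"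
proof -
  have "act f (act (scal (\<mu> n)) (v n)) = act (scal (\<mu> n)) (act f (v n))"
    using assms(1) act_mult[of f "scal (\<mu> n)" "v n"] act_mult[of "scal (\<mu> n)" f "v n"]
    by (simp add: scal_commute)
  also have "\<dots> = act (scal (s * \<mu> n)) (v m)"
    by (subst mult.commute) (simp add: assms(2) act_mult scal_mult)
  finally show ?thesis by (simp add: assms(3) act_mult scal_mult)
qed

end

section \<open>The defining relations as equations between structure constants\<close>

lemma B_rels_subset: "B_rels q G \<subseteq> carrier (free_algebra (gens G) gen_deg)"
proof -
  have v: "var x \<in> carrier (free_algebra (gens G) gen_deg)" if "x \<in> {X1, X2} \<union> Z ` {0..G}" for x
    using that by (simp add: var_closed gens_def)
  show ?thesis
    by (auto simp: B_rels_def Let_def power2_eq_square v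
        intro!: free_algebra_add_closed free_algebra_diff_closed free_algebra_mult_closed)
qed

lemma B_free_quotient:
  fixes q :: "'k::field"
  shows "free_quotient (gens G) gen_deg (B_ideal q G)"
proof (rule free_quotient.intro)
  interpret ring "B_free G :: ('k, ('k, gen) free_poly) graded"
    unfolding B_free_def by (rule free_algebra_ring)
  show "ideal (B_ideal q G) (free_algebra (gens G) gen_deg)"
    using genideal_ideal[of "B_rels q G"] B_rels_subset[of q G] by (simp add: B_ideal_def B_free_def)
qed

lemma B_alg_eq: "B_alg q G = graded_quotient (free_algebra (gens G) gen_deg) (B_ideal q G)"
  by (simp add: B_alg_def B_free_def)

lemma B_gen_eq: "B_gen q G g = B_ideal q G +>\<^bsub>free_algebra (gens G) gen_deg\<^esub> var g"
  by (simp add: B_gen_def B_free_def)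

text \<open>The coefficients of the defining relations on the basis vector of degree
  \<open>n\<close>, in the order of \<open>B_rels\<close>. In a product the left factor is evaluated
  at the degree reached by the right one.\<close>

definition B_consts :: "'k::field \<Rightarrow> nat \<Rightarrow> (gen \<Rightarrow> nat \<Rightarrow> 'k) \<Rightarrow> bool" where
  "B_consts q G c \<longleftrightarrow>
    (\<forall>n. c X2 (n + 1) * c X1 n - c X1 (n + 1) * c X2 n + 1 / 2 * (c X1 (n + 1) * c X1 n) = 0) \<and>
    (\<forall>n. c X1 (n + 1) * c (Z 0) n - q * (c (Z 0) (n + 1) * c X1 n) = 0) \<and>
    (\<forall>k<G. \<forall>n. c (Z k) (n + k + 2) * c (Z (k + 1)) n -
      inverse q * (c (Z (k + 1)) (n + k + 1) * c (Z k) n) = 0) \<and>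
    (\<forall>k<G. \<forall>n. c X2 (n + k + 1) * c (Z k) n - q * (c (Z k) (n + 1) * c X2 n) - c (Z (k + 1)) n = 0) \<and>
    (\<forall>n. c X2 (n + G + 1) * c (Z G) n - q * (c (Z G) (n + 1) * c X2 n) = 0)"

lemma B_consts_iff:
  "B_consts q G c \<longleftrightarrow> (\<forall>f\<in>B_rels q G. \<forall>h. shift_act gen_deg c f h = 0)"
proof -
  \<comment> \<open>A homogeneous relation of degree \<open>j\<close> sends each basis vector to a
    multiple \<open>e n\<close> of the one \<open>j\<close> degrees higher. The values of
    \<open>j\<close> used below are the degrees 2, 2, 2k + 3, k + 2 and G + 2 of the
    relations.\<close>
  have "(\<forall>h. shift_act gen_deg c f h = 0) \<longleftrightarrow> (\<forall>n. e n = 0)"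
    if "\<And>n. shift_act gen_deg c f (Poly_Mapping.single n 1) = Poly_Mapping.single (n + j) (e n)"
    for f j e
  proof
    assume "\<forall>h. shift_act gen_deg c f h = 0"
    then show "\<forall>n. e n = 0" using that by (metis lookup_single_eq lookup_zero)
  next
    assume "\<forall>n. e n = 0"
    then show "\<forall>h. shift_act gen_deg c f h = 0" using that by (simp add: shift_act_eq_0I)
  qed
  note eq = this
  note simps = shift_act_add_left shift_act_diff shift_act_mult shift_act_var_single shift_act_scal_single
    power2_eq_square mult.assoc single_add[symmetric] single_diff[symmetric]
  have 1: "(\<forall>h. shift_act gen_deg c (var X2 * var X1 - var X1 * var X2 + scal (1 / 2) * var X1 ^ 2) h = 0) \<longleftrightarrow>
      (\<forall>n. c X2 (n + 1) * c X1 n - c X1 (n + 1) * c X2 n + 1 / 2 * (c X1 (n + 1) * c X1 n) = 0)"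
    by (rule eq[of _ 2]) (simp add: simps)
  have 2: "(\<forall>h. shift_act gen_deg c (var X1 * var (Z 0) - scal q * var (Z 0) * var X1) h = 0) \<longleftrightarrow>
      (\<forall>n. c X1 (n + 1) * c (Z 0) n - q * (c (Z 0) (n + 1) * c X1 n) = 0)"
    by (rule eq[of _ 2]) (simp add: simps)
  have 3: "(\<forall>h. shift_act gen_deg c (var (Z k) * var (Z (k + 1)) - scal (inverse q) * var (Z (k + 1)) * var (Z k)) h = 0) \<longleftrightarrow>
      (\<forall>n. c (Z k) (n + k + 2) * c (Z (k + 1)) n -
      inverse q * (c (Z (k + 1)) (n + k + 1) * c (Z k) n) = 0)" for k
    by (rule eq[of _ "Suc (Suc (Suc (k + k)))"]) (simp add: simps add_ac)
  have 4: "(\<forall>h. shift_act gen_deg c (var X2 * var (Z k) - scal q * var (Z k) * var X2 - var (Z (k + 1))) h = 0) \<longleftrightarrow>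
      (\<forall>n. c X2 (n + k + 1) * c (Z k) n - q * (c (Z k) (n + 1) * c X2 n) - c (Z (k + 1)) n = 0)" for k
    by (rule eq[of _ "k + 2"]) (simp add: simps)
  have 5: "(\<forall>h. shift_act gen_deg c (var X2 * var (Z G) - scal q * var (Z G) * var X2) h = 0) \<longleftrightarrow>
      (\<forall>n. c X2 (n + G + 1) * c (Z G) n - q * (c (Z G) (n + 1) * c X2 n) = 0)"
    by (rule eq[of _ "G + 2"]) (simp add: simps)
  have ball: "(\<forall>f\<in>{a, b} \<union> {g n | n. n < G} \<union> {h n | n. n < G} \<union> {e}. P f) \<longleftrightarrow>
      P a \<and> P b \<and> (\<forall>n<G. P (g n)) \<and> (\<forall>n<G. P (h n)) \<and> P e"
    for a b e :: "('a, gen) free_poly" and g h P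
    by blast
  show ?thesis
    unfolding B_consts_def B_rels_def Let_def ball 1 2 3 4 5 ..
qed

section \<open>Point modules over the Laistrygonian Nichols algebra\<close>

definition std_consts :: "'k::field \<Rightarrow> 'k \<Rightarrow> 'k \<Rightarrow> 'k \<Rightarrow> gen \<Rightarrow> nat \<Rightarrow> 'k" where
  "std_consts q p0 p1 p2 g n = (case g of X1 \<Rightarrow> p0 | X2 \<Rightarrow> p1 - of_nat n / 2 * p0
     | Z k \<Rightarrow> if k = 0 then p2 / q ^ n else 0)"

text \<open>In the bracket relation for k = 0 the terms in \<open>p1 * p2\<close> cancel and - p0 p2
  / (2 q^n) remains; this is where \<open>p0 * p2 = 0\<close> enters. As G is at least 1, z_G acts
  by zero and the last relation is trivial.\<close>

lemma B_consts_std: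
  fixes q :: "'k::field_char_0"
  assumes "q \<noteq> 0" "p0 * p2 = 0" "G \<ge> 1"
  shows "B_consts q G (std_consts q p0 p1 p2)"
  unfolding B_consts_def
proof (intro conjI allI impI)
  have "p0 = 0 \<or> p2 = 0" using assms(2) by simp
  then show "std_consts q p0 p1 p2 X2 (n + k + 1) * std_consts q p0 p1 p2 (Z k) n -
      q * (std_consts q p0 p1 p2 (Z k) (n + 1) * std_consts q p0 p1 p2 X2 n) -
      std_consts q p0 p1 p2 (Z (k + 1)) n = 0" for n k
    using assms by (auto simp: std_consts_def)
qed (use assms in \<open>auto simp: std_consts_def field_simps\<close>)

text \<open>If the generators of degree 1 kill v_n, no generator leads from degree at most
  \<open>n\<close> to beyond \<open>n\<close>. Induction on k, since z_(k+1) is a q-commutator of x2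
  and z_k: in either order one of the two factors crosses the border.\<close>

lemma B_consts_crossing:
  assumes c: "B_consts q G c" and 0: "c X1 n = 0" "c X2 n = 0" "c (Z 0) n = 0"
    and "x \<in> gens G" "m \<le> n" "n < m + gen_deg x"
  shows "c x m = 0"
proof -
  have Z: "c (Z k) m = 0" if "k \<le> G" "m \<le> n" "n < m + k + 1" for k m
    using that
  proof (induction k arbitrary: m)
    case 0
    then show ?case using \<open>c (Z 0) n = 0\<close> by (cases "m = n") auto
  next
    case (Suc k)
    \<comment> \<open>Either z_k lands exactly in degree \<open>n\<close>, where x2 is zero, or z_k
      itself crosses the border.\<close>
    have "c X2 (m + k + 1) * c (Z k) m = 0"
      using Suc.IH[of m] Suc.prems 0(2) by (cases "n = m + k + 1") auto
    \<comment> \<open>Either x2 starts in degree \<open>n\<close>, where it is zero, or z_k starts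
      in degree at most \<open>n\<close> and crosses.\<close>
    moreover have "c (Z k) (m + 1) * c X2 m = 0"
      using Suc.IH[of "m + 1"] Suc.prems 0(2) by (cases "m = n") auto
    moreover have "c X2 (m + k + 1) * c (Z k) m - q * (c (Z k) (m + 1) * c X2 m) - c (Z (k + 1)) m = 0"
      using c Suc.prems(1) by (simp add: B_consts_def)
    ultimately show ?case by auto
  qed
  have "m = n" if "gen_deg x = 1" using assms(6,7) that by simp
  then show ?thesis
    using assms(5-) 0(1,2) Z by (cases x) (auto simp: gens_def)
qed

text \<open>Replacing \<open>c (Z k) n\<close> by \<open>q\<^sup>n c (Z k) n\<close> reduces the relations to the case \<open>q = 1\<close>.\<close>

lemma B_consts_normal_form:
  fixes q :: "'k::field_char_0"
  assumes q: "q \<noteq> 0" and G: "G \<ge> 1" and c: "B_consts q G c"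
    and ne: "\<And>n. c X1 n \<noteq> 0 \<or> c X2 n \<noteq> 0 \<or> c (Z 0) n \<noteq> 0"
  shows "c X1 0 * c (Z 0) 0 = 0"
    and "\<exists>\<mu>. \<mu> 0 = 1 \<and> (\<forall>n. \<mu> n \<noteq> 0 \<and> (\<forall>x\<in>gens G. c x n * \<mu> n =
      std_consts q (c X1 0) (c X2 0) (c (Z 0) 0) x n * \<mu> (n + gen_deg x)))"
proof -
  define C where "C k n = q ^ n * c (Z k) n" for k n
  have "c X2 (n + 1) * c X1 n - c X1 (n + 1) * c X2 n + 1 / 2 * c X1 (n + 1) * c X1 n = 0" for n
    using c by (simp add: B_consts_def mult.assoc)
  moreover have "c X1 (n + 1) * C 0 n = C 0 (n + 1) * c X1 n" for n
  proof -
    have "c X1 (n + 1) * c (Z 0) n = q * (c (Z 0) (n + 1) * c X1 n)" using c by (simp add: B_consts_def)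
    then show ?thesis by (simp add: C_def mult_ac)
  qed
  moreover have "C k (n + k + 2) * C (k + 1) n = C (k + 1) (n + k + 1) * C k n" if "k < G" for k n
  proof -
    have "c (Z k) (n + k + 2) * c (Z (k + 1)) n = inverse q * (c (Z (k + 1)) (n + k + 1) * c (Z k) n)"
      using c that by (simp add: B_consts_def)
    then have "q * (c (Z k) (n + k + 2) * c (Z (k + 1)) n) = c (Z (k + 1)) (n + k + 1) * c (Z k) n"
      using q by simp
    \<comment> \<open>The left-hand product of values of \<open>C\<close> carries one power of
      \<open>q\<close> more than the right-hand one; the surplus cancels the
      \<open>inverse q\<close> of the relation.\<close>
    then have "q ^ n * q ^ (n + k + 1) * (q * (c (Z k) (n + k + 2) * c (Z (k + 1)) n)) =
        q ^ n * q ^ (n + k + 1) * (c (Z (k + 1)) (n + k + 1) * c (Z k) n)" by simp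
    then show ?thesis by (simp add: C_def mult_ac)
  qed
  moreover have "c X2 (n + k + 1) * C k n - C k (n + 1) * c X2 n = C (k + 1) n" if "k < G" for k n
  proof -
    have "c X2 (n + k + 1) * c (Z k) n - q * (c (Z k) (n + 1) * c X2 n) = c (Z (k + 1)) n"
      using c that by (simp add: B_consts_def)
    then have "q ^ n * (c X2 (n + k + 1) * c (Z k) n - q * (c (Z k) (n + 1) * c X2 n)) = C (k + 1) n"
      by (simp add: C_def)
    then show ?thesis by (simp add: C_def right_diff_distrib mult_ac)
  qed
  moreover have "c X2 (n + G + 1) * C G n = C G (n + 1) * c X2 n" for n
  proof -
    have "c X2 (n + G + 1) * c (Z G) n = q * (c (Z G) (n + 1) * c X2 n)"
      using c by (simp add: B_consts_def)
    then have "q ^ n * (c X2 (n + G + 1) * c (Z G) n) = q ^ n * (q * (c (Z G) (n + 1) * c X2 n))" by simp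
    then show ?thesis by (simp add: C_def mult_ac)
  qed
  moreover have "c X1 n \<noteq> 0 \<or> c X2 n \<noteq> 0 \<or> C 0 n \<noteq> 0" for n
    using ne[of n] q by (simp add: C_def)
  ultimately have nf: "c X1 0 * C 0 0 = 0 \<and> (\<forall>k n. 1 \<le> k \<longrightarrow> k \<le> G \<longrightarrow> C k n = 0) \<and>
    (\<exists>\<mu>. \<mu> 0 = 1 \<and> (\<forall>n. \<mu> n \<noteq> 0 \<and> c X1 n * \<mu> n = c X1 0 * \<mu> (Suc n) \<and>
      c X2 n * \<mu> n = (c X2 0 - of_nat n / 2 * c X1 0) * \<mu> (Suc n) \<and> C 0 n * \<mu> n = C 0 0 * \<mu> (Suc n)))"
    using G by (intro point_normal_form)
  then show "c X1 0 * c (Z 0) 0 = 0" by (simp add: C_def)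
  from nf obtain \<mu> where \<mu>: "\<mu> 0 = 1" "\<And>n. \<mu> n \<noteq> 0"
    "\<And>n. c X1 n * \<mu> n = c X1 0 * \<mu> (Suc n)"
    "\<And>n. c X2 n * \<mu> n = (c X2 0 - of_nat n / 2 * c X1 0) * \<mu> (Suc n)"
    "\<And>n. C 0 n * \<mu> n = C 0 0 * \<mu> (Suc n)" by blast
  have "c x n * \<mu> n = std_consts q (c X1 0) (c X2 0) (c (Z 0) 0) x n * \<mu> (n + gen_deg x)"
    if x: "x \<in> gens G" for x n
  proof (cases x)
    case X1
    then show ?thesis using \<mu>(3)[of n] by (simp add: std_consts_def)
  next
    case X2
    then show ?thesis using \<mu>(4)[of n] by (simp add: std_consts_def)
  next
    case (Z k)
    show ?thesis
    proof (cases "k = 0")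
      case True
      have "q ^ n * c (Z 0) n * \<mu> n = c (Z 0) 0 * \<mu> (Suc n)" using \<mu>(5)[of n] by (simp add: C_def)
      then show ?thesis using q Z True by (simp add: std_consts_def field_simps)
    next
      case False
      then have "C k n = 0" using nf x Z by (auto simp: gens_def)
      then show ?thesis using q Z False by (simp add: C_def std_consts_def)
    qed
  qed
  then show "\<exists>\<mu>. \<mu> 0 = 1 \<and> (\<forall>n. \<mu> n \<noteq> 0 \<and> (\<forall>x\<in>gens G. c x n * \<mu> n =
      std_consts q (c X1 0) (c X2 0) (c (Z 0) 0) x n * \<mu> (n + gen_deg x)))"
    using \<mu>(1,2) by blast
qed

section \<open>Projective points and the coordinates of a point module\<close>

lemma proj_point_mem: "(a, b, c) \<in> proj_point a b c"
  unfolding proj_point_def by (intro CollectI exI[of _ 1]) simp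

lemma proj_point_scale:
  assumes "r \<noteq> 0"
  shows "proj_point (r * a) (r * b) (r * c) = proj_point a b c"
proof
  show "proj_point (r * a) (r * b) (r * c) \<subseteq> proj_point a b c"
  proof
    fix x assume "x \<in> proj_point (r * a) (r * b) (r * c)"
    then obtain t where "t \<noteq> 0" "x = (t * r * a, t * r * b, t * r * c)"
      by (auto simp: proj_point_def mult.assoc)
    then show "x \<in> proj_point a b c" using assms by (auto simp: proj_point_def intro!: exI[of _ "t * r"])
  qed
  show "proj_point a b c \<subseteq> proj_point (r * a) (r * b) (r * c)"
  proof
    fix x assume "x \<in> proj_point a b c"
    then obtain t where "t \<noteq> 0" "x = (t * a, t * b, t * c)" by (auto simp: proj_point_def)
    then show "x \<in> proj_point (r * a) (r * b) (r * c)"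
      using assms by (auto simp: proj_point_def intro!: exI[of _ "t / r"])
  qed
qed

lemma proj_point_eqD:
  assumes "proj_point a b c = proj_point a' b' c'"
  shows "\<exists>r. r \<noteq> 0 \<and> a = r * a' \<and> b = r * b' \<and> c = r * c'"
  using proj_point_mem[of a b c] unfolding assms by (auto simp: proj_point_def)

lemma point_module_basis:
  assumes "point_module (B_alg q G) V"
  shows "\<exists>u. based_module (gens G) gen_deg (B_ideal q G) V u"
proof -
  have "\<forall>n. \<exists>v\<in>hpart V n. \<forall>x\<in>hpart V n. \<exists>!s. x = kscale (B_alg q G) V s v"
    using assms by (simp add: point_module_def)
  then have "\<exists>u. \<forall>n. u n \<in> hpart V n \<and> (\<forall>x\<in>hpart V n. \<exists>!s. x = kscale (B_alg q G) V s (u n))"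
    by (intro choice) blast
  then obtain u where "\<forall>n. u n \<in> hpart V n \<and> (\<forall>x\<in>hpart V n. \<exists>!s. x = kscale (B_alg q G) V s (u n))"
    by (rule exE)
  moreover have "graded_left_module (B_alg q G) V" using assms by (simp add: point_module_def)
  ultimately show ?thesis
    by (intro exI[of _ u] based_module.intro based_module_axioms.intro B_free_quotient)
      (simp_all add: B_alg_eq)
qed

text \<open>A relation and not a function of \<open>V\<close>, because the coordinates depend on the
  chosen vectors; only the projective point is an invariant.\<close>

definition point_coords ::
  "'k::field \<Rightarrow> nat \<Rightarrow> (('k, gen) free_poly set, 'v) graded \<Rightarrow> 'v \<Rightarrow> 'v \<Rightarrow> 'k \<Rightarrow> 'k \<Rightarrow> 'k \<Rightarrow> bool" where
  "point_coords q G V v0 v1 a b c \<longleftrightarrow>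
    v0 \<in> hpart V 0 \<and> v0 \<noteq> \<zero>\<^bsub>V\<^esub> \<and> v1 \<in> hpart V 1 \<and> v1 \<noteq> \<zero>\<^bsub>V\<^esub> \<and>
    B_gen q G X1 \<odot>\<^bsub>V\<^esub> v0 = kscale (B_alg q G) V a v1 \<and>
    B_gen q G X2 \<odot>\<^bsub>V\<^esub> v0 = kscale (B_alg q G) V b v1 \<and>
    B_gen q G (Z 0) \<odot>\<^bsub>V\<^esub> v0 = kscale (B_alg q G) V c v1"

lemma point_coords_exist:
  assumes "point_module (B_alg q G) V"
    and "v0 \<in> hpart V 0" "v0 \<noteq> \<zero>\<^bsub>V\<^esub>" "v1 \<in> hpart V 1" "v1 \<noteq> \<zero>\<^bsub>V\<^esub>"
  shows "\<exists>a b c. point_coords q G V v0 v1 a b c"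
proof -
  obtain u where u: "based_module (gens G) gen_deg (B_ideal q G) V u"
    using point_module_basis[OF assms(1)] by blast
  interpret based_module "gens G" gen_deg "B_ideal q G" V u by (rule u)
  obtain s t where s: "v0 = act (scal s) (u 0)" and t: "v1 = act (scal t) (u 1)"
    using assms by (auto simp: hpart_eq)
  have "t \<noteq> 0" using assms(5) t scal_v_zero_iff by blast
  have "\<exists>r. B_gen q G x \<odot>\<^bsub>V\<^esub> v0 = kscale (B_alg q G) V r v1" if x: "x \<in> gens G" "gen_deg x = 1" for x
  proof -
    have "act (var x) v0 \<in> hpart V 1"
      using hpart_act[OF var_hpart[OF x(1)] assms(2)] x(2) by simp
    then obtain r where "act (var x) v0 = act (scal r) (u 1)" by (auto simp: hpart_eq)
    also have "\<dots> = act (scal (r / t * t)) (u 1)" using \<open>t \<noteq> 0\<close> by simp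
    also have "\<dots> = act (scal (r / t)) v1" unfolding t scal_mult by (simp add: act_mult)
    finally have "act (var x) v0 = act (scal (r / t)) v1" .
    then show ?thesis by (intro exI[of _ "r / t"]) (simp add: act_def B_alg_eq B_gen_eq kscale_eq)
  qed
  from this[of X1] this[of X2] this[of "Z 0"] show ?thesis
    using assms(2-) unfolding point_coords_def by (simp add: gens_def)
qed

text \<open>The relations yield \<open>B_consts\<close> for the constants of some homogeneous basis,
  and cyclicity yields a nonzero point in every degree; \<open>B_consts_normal_form\<close> then
  supplies the rescaling.\<close>

lemma point_coords_normal_form:
  fixes q :: "'k::field_char_0"
  assumes q: "q \<noteq> 0" and G: "G \<ge> 1" and V: "point_module (B_alg q G) V"
    and coords: "point_coords q G V v0 v1 a b c"
  shows "(a, b, c) \<noteq> (0, 0, 0)" and "a * c = 0"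
    and "\<exists>w. based_module (gens G) gen_deg (B_ideal q G) V w \<and>
      (\<forall>x\<in>gens G. \<forall>n. B_gen q G x \<odot>\<^bsub>V\<^esub> w n =
        kscale (B_alg q G) V (std_consts q a b c x n) (w (n + gen_deg x)))"
proof -
  obtain u where u: "based_module (gens G) gen_deg (B_ideal q G) V u"
    using point_module_basis[OF V] by blast
  interpret u: based_module "gens G" gen_deg "B_ideal q G" V u by (rule u)
  \<comment> \<open>The given vectors are made part of the basis, so that its constants in degree 0
    are the given \<open>a\<close>, \<open>b\<close>, \<open>c\<close>.\<close>
  define v where "v n = (if n = 0 then v0 else if n = 1 then v1 else u n)" for n
  have "u n \<noteq> \<zero>\<^bsub>V\<^esub>" for n using u.scal_v_zero_iff[of 1 n] by simp
  then have "based_module (gens G) gen_deg (B_ideal q G) V v"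
    using coords u.basis_mem by (intro u.based_module_nonzero) (auto simp: v_def point_coords_def)
  then interpret based_module "gens G" gen_deg "B_ideal q G" V v .
  have v01: "v 0 = v0" "v (Suc 0) = v1" by (simp_all add: v_def)
  have inject: "act (scal s) v1 = act (scal t) v1 \<longleftrightarrow> s = t" for s t
    using scal_v_inject[of s 1 t] by (simp add: v01)
  obtain C where C: "\<And>x n. x \<in> gens G \<Longrightarrow> act (var x) (v n) = act (scal (C x n)) (v (n + gen_deg x))"
    using consts_exist by blast
  have gens: "X1 \<in> gens G" "X2 \<in> gens G" "Z 0 \<in> gens G" by (auto simp: gens_def)
  have abc: "C X1 0 = a" "C X2 0 = b" "C (Z 0) 0 = c"
    using coords C[OF gens(1), of 0] C[OF gens(2), of 0] C[OF gens(3), of 0]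
    by (auto simp: point_coords_def B_gen_eq B_alg_eq kscale_eq v01 inject simp flip: act_def)
  have rels: "B_rels q G \<subseteq> B_ideal q G"
    using ring.genideal_self[OF free_algebra_ring B_rels_subset[of q G]] by (simp add: B_ideal_def B_free_def)
  have B: "B_consts q G C"
    unfolding B_consts_iff using shift_act_ideal[OF C] rels by blast
  \<comment> \<open>If this failed, no generator would cross degree \<open>n\<close>, and the cyclic
    vector in degree 0 could not reach \<open>v (Suc n)\<close>.\<close>
  have ne: "C X1 n \<noteq> 0 \<or> C X2 n \<noteq> 0 \<or> C (Z 0) n \<noteq> 0" for n
  proof (rule ccontr)
    assume "\<not> ?thesis"
    then have cross: "C x m = 0" if "x \<in> gens G" "m \<le> n" "n < m + gen_deg x" for x m
      using B_consts_crossing[OF B, of n x m] that by blast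
    obtain y where y: "y \<in> hpart V 0" "carrier V = (\<lambda>a. a \<odot>\<^bsub>V\<^esub> y) ` carrier (B_alg q G)"
      using V by (auto simp: point_module_def)
    obtain s where s: "y = act (scal s) (v 0)" using y(1) by (auto simp: hpart_eq)
    have "v (Suc n) \<in> (\<lambda>a. a \<odot>\<^bsub>V\<^esub> y) ` carrier u.A" using y(2) v_closed[of "Suc n"] by (simp add: B_alg_eq)
    then obtain f where f: "f \<in> carrier u.F" "v (Suc n) = act f y"
      by (auto simp: u.carrier_quotient act_def)
    have "lincomb (Poly_Mapping.single (Suc n) 1) = v (Suc n)" by (simp add: lincomb_single)
    also have "\<dots> = lincomb (shift_act gen_deg C f (Poly_Mapping.single 0 s))"
      using lincomb_act[OF C f(1), of "Poly_Mapping.single 0 s"] f(2) by (simp add: lincomb_single s)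
    finally have "Poly_Mapping.single (Suc n) 1 = shift_act gen_deg C f (Poly_Mapping.single 0 s)"
      by (simp only: lincomb_inject)
    then have "Poly_Mapping.lookup (Poly_Mapping.single (Suc n) (1 :: 'k)) (Suc n) = 0"
      using lookup_shift_act_eq_0[of "gens G" n gen_deg C f s] cross f(1) by simp
    then show False by simp
  qed
  show "(a, b, c) \<noteq> (0, 0, 0)" using ne[of 0] abc by auto
  show "a * c = 0" using B_consts_normal_form(1)[OF q G B ne] abc by simp
  obtain \<mu> where \<mu>: "\<And>n. \<mu> n \<noteq> 0"
    "\<And>x n. x \<in> gens G \<Longrightarrow> C x n * \<mu> n = std_consts q a b c x n * \<mu> (n + gen_deg x)"
    using B_consts_normal_form(2)[OF q G B ne] abc by blast
  have "B_gen q G x \<odot>\<^bsub>V\<^esub> act (scal (\<mu> n)) (v n) =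
      kscale (B_alg q G) V (std_consts q a b c x n) (act (scal (\<mu> (n + gen_deg x))) (v (n + gen_deg x)))"
    if x: "x \<in> gens G" for x n
    using rescale_act[where \<mu> = \<mu>, OF var_closed[OF x] C[OF x] \<mu>(2)[OF x], of n]
    by (simp add: B_gen_eq B_alg_eq kscale_eq flip: act_def)
  then show "\<exists>w. based_module (gens G) gen_deg (B_ideal q G) V w \<and>
      (\<forall>x\<in>gens G. \<forall>n. B_gen q G x \<odot>\<^bsub>V\<^esub> w n =
        kscale (B_alg q G) V (std_consts q a b c x n) (w (n + gen_deg x)))"
    using rescale[of \<mu>, OF \<mu>(1)] by (intro exI[of _ "\<lambda>n. act (scal (\<mu> n)) (v n)"]) blast
qed

text \<open>Another choice of the two vectors multiplies all three coordinates by one common factor.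
  It is found by comparing both choices with a fixed basis \<open>u\<close>.\<close>

lemma point_coords_proj_point:
  assumes V: "point_module (B_alg q G) V"
    and "point_coords q G V v0 v1 a b c" "point_coords q G V w0 w1 a' b' c'"
  shows "proj_point a b c = proj_point a' b' c'"
proof -
  obtain u where u: "based_module (gens G) gen_deg (B_ideal q G) V u"
    using point_module_basis[OF V] by blast
  interpret based_module "gens G" gen_deg "B_ideal q G" V u by (rule u)
  obtain s t s' t' where st: "v0 = act (scal s) (u 0)" "v1 = act (scal t) (u 1)"
    "w0 = act (scal s') (u 0)" "w1 = act (scal t') (u 1)"
    using assms(2,3) by (auto simp: hpart_eq point_coords_def)
  then have nz: "s \<noteq> 0" "t \<noteq> 0" "s' \<noteq> 0" "t' \<noteq> 0"
    using assms(2,3) scal_v_zero_iff by (auto simp: point_coords_def)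
  obtain C where C: "\<And>x n. x \<in> gens G \<Longrightarrow> act (var x) (u n) = act (scal (C x n)) (u (n + gen_deg x))"
    using consts_exist by blast
  have eq: "a * t = C x 0 * s"
    if x: "x \<in> gens G" "gen_deg x = 1" and
      "B_gen q G x \<odot>\<^bsub>V\<^esub> act (scal s) (u 0) = kscale (B_alg q G) V a (act (scal t) (u 1))" for x a s t
  proof -
    have "act (scal (a * t)) (u 1) = act (var x * scal s) (u 0)"
      using that by (simp add: act_mult scal_mult var_closed B_gen_eq B_alg_eq kscale_eq flip: act_def)
    also have "\<dots> = act (scal s * var x) (u 0)" by (simp add: scal_commute)
    also have "\<dots> = act (scal (s * C x 0)) (u 1)"
      using C[OF x(1), of 0] x by (simp add: act_mult scal_mult var_closed)
    finally show ?thesis by (simp add: scal_v_inject mult.commute)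
  qed
  have gens: "X1 \<in> gens G" "X2 \<in> gens G" "Z 0 \<in> gens G" by (auto simp: gens_def)
  note eqs = eq[OF gens(1)] eq[OF gens(2)] eq[OF gens(3)]
  have "a * t = C X1 0 * s" "b * t = C X2 0 * s" "c * t = C (Z 0) 0 * s"
    "a' * t' = C X1 0 * s'" "b' * t' = C X2 0 * s'" "c' * t' = C (Z 0) 0 * s'"
    using assms(2,3) eqs by (auto simp: point_coords_def st)
  moreover have "x = s * t' / (s' * t) * x'" if "x * t = k * s" "x' * t' = k * s'" for x x' k
  proof -
    have "x * t * s' = x' * t' * s" using that by (simp add: mult_ac)
    then show ?thesis using nz by (simp add: field_simps)
  qed
  ultimately have *: "a = s * t' / (s' * t) * a'" "b = s * t' / (s' * t) * b'" "c = s * t' / (s' * t) * c'"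
    by blast+
  show ?thesis
    unfolding * by (rule proj_point_scale) (use nz in simp)
qed

lemma point_coords_iso:
  assumes V: "point_module (B_alg q G) V" and W: "point_module (B_alg q G) W"
    and f: "graded_iso (B_alg q G) V W f" and coords: "point_coords q G V v0 v1 a b c"
  shows "point_coords q G W (f v0) (f v1) a b c"
proof -
  interpret V: left_module "B_alg q G" V
    using V by (simp add: point_module_def graded_left_module_def)
  interpret W: left_module "B_alg q G" W
    using W by (simp add: point_module_def graded_left_module_def)
  interpret free_quotient "gens G" gen_deg "B_ideal q G" by (rule B_free_quotient)
  have inj: "inj_on f (carrier V)" and closed: "x \<in> carrier V \<Longrightarrow> f x \<in> carrier W" for x
    using f by (auto simp: graded_iso_def bij_betw_def)
  have hpart: "x \<in> hpart V n \<Longrightarrow> f x \<in> hpart W n" for x n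
    using f unfolding graded_iso_def by blast
  have carrier: "x \<in> hpart V n \<Longrightarrow> x \<in> carrier V" for x n
    using V by (auto simp: point_module_def graded_left_module_def dest: additive_subgroup.a_subset)
  have act: "f (coset p \<odot>\<^bsub>V\<^esub> x) = coset p \<odot>\<^bsub>W\<^esub> f x" if "p \<in> carrier (free_algebra (gens G) gen_deg)" "x \<in> carrier V" for p x
    using f that by (simp add: graded_iso_def B_alg_eq)
  have "f \<zero>\<^bsub>V\<^esub> \<oplus>\<^bsub>W\<^esub> f \<zero>\<^bsub>V\<^esub> = f (\<zero>\<^bsub>V\<^esub> \<oplus>\<^bsub>V\<^esub> \<zero>\<^bsub>V\<^esub>)"
    using f V.M.zero_closed unfolding graded_iso_def by metis
  then have "f \<zero>\<^bsub>V\<^esub> = \<zero>\<^bsub>W\<^esub>"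
    using closed[of "\<zero>\<^bsub>V\<^esub>"] W.M.add.r_cancel_one[of "f \<zero>\<^bsub>V\<^esub>" "f \<zero>\<^bsub>V\<^esub>"] by simp
  then have nz: "f x \<noteq> \<zero>\<^bsub>W\<^esub>" if "x \<in> carrier V" "x \<noteq> \<zero>\<^bsub>V\<^esub>" for x
    using inj that by (metis V.M.zero_closed inj_onD)
  have gen: "B_gen q G x \<odot>\<^bsub>W\<^esub> f v0 = kscale (B_alg q G) W r (f v1)"
    if "x \<in> gens G" "B_gen q G x \<odot>\<^bsub>V\<^esub> v0 = kscale (B_alg q G) V r v1" for x r
  proof -
    have "v0 \<in> carrier V" "v1 \<in> carrier V" using coords carrier by (auto simp: point_coords_def)
    moreover have "coset (var x) \<odot>\<^bsub>V\<^esub> v0 = coset (scal r) \<odot>\<^bsub>V\<^esub> v1"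
      using that(2) unfolding kscale_def B_gen_eq B_alg_eq coset_scalar .
    ultimately have "coset (var x) \<odot>\<^bsub>W\<^esub> f v0 = coset (scal r) \<odot>\<^bsub>W\<^esub> f v1"
      using act[OF var_closed[OF that(1)], of v0] act[of "scal r" v1] by simp
    then show ?thesis unfolding kscale_def B_gen_eq B_alg_eq coset_scalar .
  qed
  have gens: "X1 \<in> gens G" "X2 \<in> gens G" "Z 0 \<in> gens G" by (auto simp: gens_def)
  show ?thesis
    using coords gen[OF gens(1)] gen[OF gens(2)] gen[OF gens(3)] hpart nz carrier
    unfolding point_coords_def by blast
qed

text \<open>Dividing the vector of degree 1 by \<open>r\<close> multiplies the coordinates by
  \<open>r\<close>. This upgrades equality of projective points to equality of coordinates, so that
  two modules get the same normal form.\<close>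

lemma point_coords_rescale:
  assumes V: "point_module (B_alg q G) V" and coords: "point_coords q G V v0 v1 a b c" and "r \<noteq> 0"
  shows "\<exists>w1. point_coords q G V v0 w1 (r * a) (r * b) (r * c)"
proof -
  obtain u where u: "based_module (gens G) gen_deg (B_ideal q G) V u"
    using point_module_basis[OF V] by blast
  interpret based_module "gens G" gen_deg "B_ideal q G" V u by (rule u)
  obtain t where t: "v1 = act (scal t) (u 1)" using coords by (auto simp: hpart_eq point_coords_def)
  have "t \<noteq> 0" using coords t scal_v_zero_iff by (auto simp: point_coords_def)
  have "act (scal s) v1 = act (scal (r * s)) (act (scal (t / r)) (u 1))" for s
  proof -
    have "act (scal s) v1 = act (scal (s * t)) (u 1)" by (simp add: t act_mult scal_mult)
    also have "s * t = (r * s) * (t / r)" using \<open>r \<noteq> 0\<close> by simp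
    also have "act (scal \<dots>) (u 1) = act (scal (r * s)) (act (scal (t / r)) (u 1))"
      by (rule act_scal_mult) simp
    finally show ?thesis .
  qed
  then have "kscale (B_alg q G) V s v1 = kscale (B_alg q G) V (r * s) (act (scal (t / r)) (u 1))" for s
    by (simp add: B_alg_eq kscale_eq)
  moreover have "act (scal (t / r)) (u 1) \<in> hpart V 1" by (auto simp: hpart_eq)
  moreover have "act (scal (t / r)) (u 1) \<noteq> \<zero>\<^bsub>V\<^esub>"
    using \<open>t \<noteq> 0\<close> \<open>r \<noteq> 0\<close> by (simp add: scal_v_zero_iff)
  ultimately show ?thesis
    using coords unfolding point_coords_def by (intro exI[of _ "act (scal (t / r)) (u 1)"]) simp
qed

section \<open>The invariant point and the classification\<close>

definition the_point :: "'k::field \<Rightarrow> nat \<Rightarrow> (('k, gen) free_poly set, 'v) graded \<Rightarrow> ('k \<times> 'k \<times> 'k) set" where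
  "the_point q G V = (THE P. \<exists>v0 v1 a b c. point_coords q G V v0 v1 a b c \<and> P = proj_point a b c)"

lemma the_point_eq:
  assumes "point_module (B_alg q G) V" "point_coords q G V v0 v1 a b c"
  shows "the_point q G V = proj_point a b c"
  unfolding the_point_def
proof (rule the_equality)
  fix P assume "\<exists>v0 v1 a b c. point_coords q G V v0 v1 a b c \<and> P = proj_point a b c"
  then show "P = proj_point a b c" using point_coords_proj_point[OF assms(1) _ assms(2)] by blast
qed (use assms(2) in blast)

lemma point_module_coords:
  assumes "point_module (B_alg q G) V"
  shows "\<exists>v0 v1 a b c. point_coords q G V v0 v1 a b c"
proof -
  obtain u where u: "based_module (gens G) gen_deg (B_ideal q G) V u"
    using point_module_basis[OF assms] by blast
  interpret based_module "gens G" gen_deg "B_ideal q G" V u by (rule u)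
  have "u n \<noteq> \<zero>\<^bsub>V\<^esub>" for n using scal_v_zero_iff[of 1 n] by simp
  then show ?thesis using point_coords_exist[OF assms basis_mem _ basis_mem] by blast
qed

text \<open>An isomorphism transports coordinates, so the point is an invariant. Conversely, equal
  points allow equal coordinates, hence bases with the same constants \<open>std_consts\<close>, and
  \<open>based_module_iso\<close> applies. The two directions are well-definedness and injectivity
  of the parametrization.\<close>

lemma point_module_iso_iff:
  fixes q :: "'k::field_char_0"
  assumes q: "q \<noteq> 0" and G: "G \<ge> 1"
    and V: "point_module (B_alg q G) V" and W: "point_module (B_alg q G) W"
  shows "(\<exists>f. graded_iso (B_alg q G) V W f) \<longleftrightarrow> the_point q G V = the_point q G W"
proof -
  obtain v0 v1 a b c where v: "point_coords q G V v0 v1 a b c"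
    using point_module_coords[OF V] by blast
  show ?thesis
  proof
    assume "\<exists>f. graded_iso (B_alg q G) V W f"
    then show "the_point q G V = the_point q G W"
      using the_point_eq[OF V v] the_point_eq[OF W] point_coords_iso[OF V W _ v] by metis
  next
    assume eq: "the_point q G V = the_point q G W"
    obtain w0 w1 a' b' c' where w: "point_coords q G W w0 w1 a' b' c'"
      using point_module_coords[OF W] by blast
    have "proj_point a b c = proj_point a' b' c'"
      using eq the_point_eq[OF V v] the_point_eq[OF W w] by simp
    then obtain r where r: "r \<noteq> 0" "a = r * a'" "b = r * b'" "c = r * c'"
      using proj_point_eqD by blast
    then obtain w1' where w': "point_coords q G W w0 w1' a b c"
      using point_coords_rescale[OF W w r(1)] by blast
    obtain v where v': "based_module (gens G) gen_deg (B_ideal q G) V v"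
      "\<And>x n. x \<in> gens G \<Longrightarrow> B_gen q G x \<odot>\<^bsub>V\<^esub> v n =
        kscale (B_alg q G) V (std_consts q a b c x n) (v (n + gen_deg x))"
      using point_coords_normal_form(3)[OF q G V v] by blast
    obtain w where w'': "based_module (gens G) gen_deg (B_ideal q G) W w"
      "\<And>x n. x \<in> gens G \<Longrightarrow> B_gen q G x \<odot>\<^bsub>W\<^esub> w n =
        kscale (B_alg q G) W (std_consts q a b c x n) (w (n + gen_deg x))"
      using point_coords_normal_form(3)[OF q G W w'] by blast
    show "\<exists>f. graded_iso (B_alg q G) V W f"
      unfolding B_alg_eq
      by (rule based_module_iso[OF v'(1) w''(1) v'(2)[unfolded B_gen_eq B_alg_eq]
            w''(2)[unfolded B_gen_eq B_alg_eq]])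
  qed
qed

lemma the_point_variety:
  fixes q :: "'k::field_char_0"
  assumes "q \<noteq> 0" "G \<ge> 1" "point_module (B_alg q G) V"
  shows "the_point q G V \<in> variety_X0X2"
proof -
  obtain v0 v1 a b c where v: "point_coords q G V v0 v1 a b c"
    using point_module_coords[OF assms(3)] by blast
  note nf = point_coords_normal_form(1,2)[OF assms v]
  have "proj_point a b c \<in> proj_plane" using nf(1) by (auto simp: proj_plane_def)
  then show ?thesis
    using nf(2) by (auto simp: the_point_eq[OF assms(3) v] variety_X0X2_def proj_point_def)
qed

text \<open>The module is the shift model with constants \<open>std_consts q a b c\<close>; it is
  cyclic because in every degree x1 is nonzero if \<open>a\<close> is, and otherwise x2 or z_0
  is.\<close>

lemma the_point_surj:
  fixes q :: "'k::field_char_0" and emb :: "(nat \<Rightarrow>\<^sub>0 'k) \<Rightarrow> 'v"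
  assumes q: "q \<noteq> 0" and G: "G \<ge> 1" and emb: "inj emb" and P: "P \<in> variety_X0X2"
  shows "\<exists>V :: (('k, gen) free_poly set, 'v) graded. point_module (B_alg q G) V \<and> the_point q G V = P"
proof -
  obtain a b c where abc: "(a, b, c) \<noteq> (0, 0, 0)" "P = proj_point a b c"
    using P by (auto simp: variety_X0X2_def proj_plane_def)
  have ac: "a * c = 0" using P proj_point_mem[of a b c] by (auto simp: variety_X0X2_def abc(2))
  let ?c = "std_consts q a b c"
  have B: "B_consts q G ?c" by (rule B_consts_std[OF q ac G])
  interpret free_quotient "gens G" gen_deg "B_ideal q G" by (rule B_free_quotient)
  interpret shift_model "gens G" gen_deg "B_ideal q G" emb ?c
  proof
    show "shift_act gen_deg ?c f h = 0" if "f \<in> B_ideal q G" for f h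
      by (rule shift_act_genideal[OF B_rels_subset[of q G]])
        (use B that in \<open>auto simp: B_consts_iff B_ideal_def B_free_def\<close>)
  qed (rule emb)
  have gens: "X1 \<in> gens G" "X2 \<in> gens G" "Z 0 \<in> gens G" by (auto simp: gens_def)
  have ne: "\<exists>x\<in>gens G. gen_deg x = 1 \<and> ?c x n \<noteq> 0" for n
  proof (cases "a = 0")
    case True
    then have "?c X2 n \<noteq> 0 \<or> ?c (Z 0) n \<noteq> 0" using abc(1) q by (auto simp: std_consts_def)
    then show ?thesis using gens by force
  next
    case False
    then show ?thesis using gens by (intro bexI[of _ X1]) (simp_all add: std_consts_def)
  qed
  have V: "point_module (B_alg q G) M"
    unfolding B_alg_eq by (intro point_module_M shift_act_cyclic ne)
  have gen: "B_gen q G x \<odot>\<^bsub>M\<^esub> emb (Poly_Mapping.single 0 1) =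
      kscale (B_alg q G) M (?c x 0) (emb (Poly_Mapping.single 1 1))"
    if "x \<in> gens G" "gen_deg x = 1" for x
    using that shift_act_var_single[of gen_deg ?c x 0 1] smult[OF var_closed[OF that(1)], of 1]
    by (simp add: B_gen_eq B_alg_eq kscale_M)
  have nz: "emb (Poly_Mapping.single n 1) \<noteq> \<zero>\<^bsub>M\<^esub>" for n
    using emb by (auto simp: inj_def) (metis lookup_single_eq lookup_zero zero_neq_one)
  have "point_coords q G M (emb (Poly_Mapping.single 0 1)) (emb (Poly_Mapping.single 1 1)) a b c"
    using gen[of X1] gen[of X2] gen[of "Z 0"] gens nz[of 0] nz[of 1]
    by (simp add: point_coords_def std_consts_def)
  then show ?thesis using V the_point_eq[OF V] abc(2) by blast
qed

theorem theorem5p2: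
  fixes q :: "'k::{alg_closed_field, field_char_0}"
    and G :: nat
    and emb :: "(nat \<Rightarrow>\<^sub>0 'k) \<Rightarrow> 'v"
  assumes "q \<noteq> 0" and "G \<ge> 1" and "inj emb"
  shows "\<exists>\<Phi>. bij_betw \<Phi>
      (point_module_classes (B_alg q G) :: (('k, gen) free_poly set, 'v) graded set set)
      variety_X0X2 \<and>
    (\<forall>(V :: (('k, gen) free_poly set, 'v) graded) v.
      point_module (B_alg q G) V \<and> (\<forall>n. v n \<in> hpart V n \<and> v n \<noteq> \<zero>\<^bsub>V\<^esub>) \<longrightarrow>
      (\<exists>a0 b0 c0.
        B_gen q G X1 \<odot>\<^bsub>V\<^esub> v 0 = kscale (B_alg q G) V a0 (v 1) \<and>
        B_gen q G X2 \<odot>\<^bsub>V\<^esub> v 0 = kscale (B_alg q G) V b0 (v 1) \<and>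
        B_gen q G (Z 0) \<odot>\<^bsub>V\<^esub> v 0 = kscale (B_alg q G) V c0 (v 1) \<and>
        (a0, b0, c0) \<noteq> (0, 0, 0) \<and>
        \<Phi> (iso_class (B_alg q G) V) = proj_point a0 b0 c0))"
proof -
  let ?pm = "\<lambda>V :: (('k, gen) free_poly set, 'v) graded. point_module (B_alg q G) V"
  let ?cl = "\<lambda>V :: (('k, gen) free_poly set, 'v) graded. iso_class (B_alg q G) V"
  define \<Phi> where "\<Phi> K = the_point q G (SOME V. V \<in> K)"
    for K :: "(('k, gen) free_poly set, 'v) graded set"
  \<comment> \<open>Isomorphism classes are the fibres of \<open>the_point\<close>. Hence the
    representative chosen in \<open>\<Phi>\<close> does not affect its value, and classes with the
    same value coincide.\<close>
  have cl: "?cl V = {W. ?pm W \<and> the_point q G V = the_point q G W}" if "?pm V" for V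
    using that point_module_iso_iff[OF assms(1,2)]
    by (auto simp: iso_class_def point_module_iso_rel_def)
  have \<Phi>: "\<Phi> (?cl V) = the_point q G V" if V: "?pm V" for V
  proof -
    have "(SOME W. W \<in> ?cl V) \<in> ?cl V" by (rule someI[of _ V]) (simp add: cl V)
    then show ?thesis by (simp add: \<Phi>_def cl V)
  qed
  have classes: "point_module_classes (B_alg q G) = ?cl ` {V. ?pm V}"
    by (auto simp: point_module_classes_def quotient_def iso_class_def)
  have "bij_betw \<Phi> (point_module_classes (B_alg q G)) variety_X0X2"
    unfolding bij_betw_def
  proof
    show "inj_on \<Phi> (point_module_classes (B_alg q G))"
    proof (rule inj_onI)
      fix K L assume "K \<in> point_module_classes (B_alg q G)" "L \<in> point_module_classes (B_alg q G)" "\<Phi> K = \<Phi> L"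
      then obtain V W where "?pm V" "?pm W" "K = ?cl V" "L = ?cl W" "the_point q G V = the_point q G W"
        unfolding classes using \<Phi> by auto
      then show "K = L" using cl by simp
    qed
    show "\<Phi> ` point_module_classes (B_alg q G) = variety_X0X2"
    proof
      show "\<Phi> ` point_module_classes (B_alg q G) \<subseteq> variety_X0X2"
        unfolding classes using the_point_variety[OF assms(1,2)] by (auto simp: \<Phi>)
      show "variety_X0X2 \<subseteq> \<Phi> ` point_module_classes (B_alg q G)"
      proof
        fix P :: "('k \<times> 'k \<times> 'k) set" assume "P \<in> variety_X0X2"
        then obtain V where "?pm V" "the_point q G V = P"
          using the_point_surj[OF assms] by blast
        then show "P \<in> \<Phi> ` point_module_classes (B_alg q G)"
          unfolding classes using \<Phi> by blast
      qed
    qed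
  qed
  moreover have "\<exists>a0 b0 c0.
        B_gen q G X1 \<odot>\<^bsub>V\<^esub> v 0 = kscale (B_alg q G) V a0 (v 1) \<and>
        B_gen q G X2 \<odot>\<^bsub>V\<^esub> v 0 = kscale (B_alg q G) V b0 (v 1) \<and>
        B_gen q G (Z 0) \<odot>\<^bsub>V\<^esub> v 0 = kscale (B_alg q G) V c0 (v 1) \<and>
        (a0, b0, c0) \<noteq> (0, 0, 0) \<and>
        \<Phi> (?cl V) = proj_point a0 b0 c0"
    if V: "?pm V" and v: "\<forall>n. v n \<in> hpart V n \<and> v n \<noteq> \<zero>\<^bsub>V\<^esub>" for V v
  proof -
    obtain a b c where abc: "point_coords q G V (v 0) (v 1) a b c"
      using point_coords_exist[OF V] v by blast
    then show ?thesis
      using point_coords_normal_form(1)[OF assms(1,2) V abc] \<Phi>[OF V] the_point_eq[OF V abc]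
      unfolding point_coords_def by blast
  qed
  ultimately show ?thesis by blast
qed

end
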